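(* Let $1\le q\le p<\infty$, let $X,Y$ be Banach lattices and $E,F$ Banach spaces. (1) A bounded linear $T:X\to F$ is left positive Cohen $(p,q)$-nuclear if and only if $T^{\ast}:F^{\ast}\to X^{\ast}$ is right positive Cohen $(q^{\ast},p^{\ast})$-nuclear; moreover $\|T\|_{\mathcal{CN}^{left,+}_{p,q}}=\|T^{\ast}\|_{\mathcal{CN}^{right,+}_{q^{\ast},p^{\ast}}}$. (2) A bounded linear $T:E\to Y$ is right positive Cohen $(p,q)$-nuclear if and only if $T^{\ast}:Y^{\ast}\to E^{\ast}$ is left positive Cohen $(q^{\ast},p^{\ast})$-nuclear; moreover $\|T\|_{\mathcal{CN}^{right,+}_{p,q}}=\|T^{\ast}\|_{\mathcal{CN}^{left,+}_{q^{\ast},p^{\ast}}}$. (3) A bounded linear $T:X\to Y$ is positive Cohen $(p,q)$-nuclear if and only if $T^{\ast}:Y^{\ast}\to X^{\ast}$ is positive Cohen $(q^{\ast},p^{\ast})$-nuclear; moreover $\|T\|_{\mathcal{CN}^{+}_{p,q}}=\|T^{\ast}\|_{\mathcal{CN}^{+}_{q^{\ast},p^{\ast}}}$.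
   Context: $r^{\ast}$ denotes the conjugate exponent of $r$; duals of Banach lattices are Banach lattices. For a Banach space $G$: $\|(x_i)\|_{r,\omega}=\sup_{x^{\ast}\in B_{G^{\ast}}}\|(\langle x_i,x^{\ast}\rangle)_i\|_r$; $\ell_r\langle G\rangle$ (Cohen strongly $r$-summable sequences) has norm $\|(x_i)\|_{\ell_r\langle G\rangle}=\sup\{|\sum_i x_i^{\ast}(x_i)|:\|(x_i^{\ast})\|_{r^{\ast},\omega}\le1\}$. For a Banach lattice $Z$: $\|(z_i)\|_{r,|\omega|}=\sup_{z^{\ast}\in B_{Z^{\ast}}\cap Z^{\ast}_+}(\sum_i\langle z^{\ast},|z_i|\rangle^{r})^{1/r}$ (with the usual modification for $r=\infty$); $\ell_r^{\pi}(Z)$ for $1<r\le\infty$ has norm $\|(z_i)\|_{\ell_r^{\pi}(Z)}=\sup\sum_i\langle z_i^{\ast},|z_i|\rangle$ over positive $(z_i^{\ast})$ in $Z^{\ast}$ with $\sup_{z\in B_Z\cap Z_+}\|(\langle|z_i^{\ast}|,z\rangle)_i\|_{r^{\ast}}\le1$, and $\ell_1^{\pi}(Z)=\ell_1(Z)$ by convention. For Banach lattice $Z$, Banach lattice $W$, Banach spaces $G,H$ and exponents $p,q$ (all inequalities for all finite families, $C$ independent): $S:Z\to H$ is left positive Cohen $(p,q)$-nuclear if $\|(S(z_i))\|_{\ell_p\langle H\rangle}\le C\|(z_i)\|_{q,|\omega|}$; $S:G\to W$ is right positive Cohen $(p,q)$-nuclear if $\|(S(x_i))\|_{\ell_p^{\pi}(W)}\le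 C\|(x_i)\|_{q,\omega}$; $S:Z\to W$ is positive Cohen $(p,q)$-nuclear if $\|(S(z_i))\|_{\ell_p^{\pi}(W)}\le C\|(z_i)\|_{q,|\omega|}$. In each case the corresponding norm $\|S\|_{\mathcal{CN}^{left,+}_{p,q}}$, $\|S\|_{\mathcal{CN}^{right,+}_{p,q}}$, $\|S\|_{\mathcal{CN}^{+}_{p,q}}$ is the infimum of such $C$. *)

theory Defs
  imports "HOL-Analysis.Analysis"
begin

class banach_lattice = banach + ordered_real_vector + lattice +
  assumes norm_lattice_mono: "sup x (- x) \<le> sup y (- y) \<Longrightarrow> norm x \<le> norm y"

definition labs :: "'a::banach_lattice \<Rightarrow> 'a" where
  "labs x = sup x (- x)"

text \<open>Dual Banach lattice Z* = 'z \<Rightarrow>L real: order via positive functionals,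
  modulus via the Riesz--Kantorovich formula (a linear functional is determined
  by its values on the positive cone).\<close>

definition dpos :: "('z::banach_lattice \<Rightarrow>\<^sub>L real) \<Rightarrow> bool" where
  "dpos f \<longleftrightarrow> (\<forall>x. 0 \<le> x \<longrightarrow> 0 \<le> f x)"

definition dabs :: "('z::banach_lattice \<Rightarrow>\<^sub>L real) \<Rightarrow> ('z \<Rightarrow>\<^sub>L real)" where
  "dabs f = (SOME g::'z \<Rightarrow>\<^sub>L real. \<forall>x. 0 \<le> x \<longrightarrow> blinfun_apply g x = Sup {\<bar>f y\<bar> | y. labs y \<le> x})"

definition conj_exp :: "ereal \<Rightarrow> ereal" where
  "conj_exp r = (if r = 1 then \<infinity> else if r = \<infinity> then 1
                 else ereal (real_of_ereal r / (real_of_ereal r - 1)))"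

definition lpn :: "ereal \<Rightarrow> (nat \<Rightarrow> real) \<Rightarrow> nat \<Rightarrow> real" where
  "lpn r a n = (if r = \<infinity> then Sup (insert 0 ((\<lambda>i. \<bar>a i\<bar>) ` {..<n}))
               else (\<Sum>i<n. \<bar>a i\<bar> powr real_of_ereal r) powr (1 / real_of_ereal r))"

definition wnorm :: "ereal \<Rightarrow> (nat \<Rightarrow> 'g::real_normed_vector) \<Rightarrow> nat \<Rightarrow> real" where
  "wnorm r x n = Sup ((\<lambda>xs. lpn r (\<lambda>i. blinfun_apply xs (x i)) n) ` {xs :: 'g \<Rightarrow>\<^sub>L real. norm xs \<le> 1})"

definition cohen_norm :: "ereal \<Rightarrow> (nat \<Rightarrow> 'g::real_normed_vector) \<Rightarrow> nat \<Rightarrow> real" where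
  "cohen_norm r x n = Sup ((\<lambda>xs. \<bar>\<Sum>i<n. blinfun_apply (xs i) (x i)\<bar>) `
          {xs :: nat \<Rightarrow> ('g \<Rightarrow>\<^sub>L real). wnorm (conj_exp r) xs n \<le> 1})"

text \<open>A Banach lattice structure on the Banach space 'z is described by its positive
  cone pos and its modulus absv.  Positivity of dual functionals:\<close>
definition posfun :: "('z \<Rightarrow> bool) \<Rightarrow> ('z::real_normed_vector \<Rightarrow>\<^sub>L real) \<Rightarrow> bool" where
  "posfun pos \<phi> \<longleftrightarrow> (\<forall>w. pos w \<longrightarrow> 0 \<le> \<phi> w)"

definition absweak :: "('z \<Rightarrow> bool) \<Rightarrow> ('z \<Rightarrow> 'z) \<Rightarrow> ereal \<Rightarrow> (nat \<Rightarrow> 'z::real_normed_vector)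
    \<Rightarrow> nat \<Rightarrow> real" where
  "absweak pos absv r z n = Sup ((\<lambda>\<phi>. lpn r (\<lambda>i. blinfun_apply \<phi> (absv (z i))) n) `
                                 {\<phi> :: 'z \<Rightarrow>\<^sub>L real. norm \<phi> \<le> 1 \<and> posfun pos \<phi>})"

definition pinorm :: "('z \<Rightarrow> bool) \<Rightarrow> ('z \<Rightarrow> 'z) \<Rightarrow> ereal \<Rightarrow> (nat \<Rightarrow> 'z::real_normed_vector)
    \<Rightarrow> nat \<Rightarrow> real" where
  "pinorm pos absv r z n =
     (if r = 1 then (\<Sum>i<n. norm (z i))
      else Sup ((\<lambda>zs. \<Sum>i<n. blinfun_apply (zs i) (absv (z i))) `
            {zs :: nat \<Rightarrow> ('z \<Rightarrow>\<^sub>L real). (\<forall>i. posfun pos (zs i)) \<and>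
               Sup ((\<lambda>w. lpn (conj_exp r) (\<lambda>i. blinfun_apply (zs i) w) n) `
                    {w. norm w \<le> 1 \<and> pos w}) \<le> 1}))"

definition left_pcn_ineq :: "('z \<Rightarrow> bool) \<Rightarrow> ('z \<Rightarrow> 'z) \<Rightarrow> ereal \<Rightarrow> ereal
    \<Rightarrow> ('z::real_normed_vector \<Rightarrow> 'h::real_normed_vector) \<Rightarrow> real \<Rightarrow> bool" where
  "left_pcn_ineq pos absv p q S C \<longleftrightarrow>
     (\<forall>n z. cohen_norm p (\<lambda>i. S (z i)) n \<le> C * absweak pos absv q z n)"

definition right_pcn_ineq :: "('w \<Rightarrow> bool) \<Rightarrow> ('w \<Rightarrow> 'w) \<Rightarrow> ereal \<Rightarrow> ereal
    \<Rightarrow> ('g::real_normed_vector \<Rightarrow> 'w::real_normed_vector) \<Rightarrow> real \<Rightarrow> bool" where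
  "right_pcn_ineq pos absv p q S C \<longleftrightarrow>
     (\<forall>n x. pinorm pos absv p (\<lambda>i. S (x i)) n \<le> C * wnorm q x n)"

definition pcn_ineq :: "('z \<Rightarrow> bool) \<Rightarrow> ('z \<Rightarrow> 'z) \<Rightarrow> ('w \<Rightarrow> bool) \<Rightarrow> ('w \<Rightarrow> 'w)
    \<Rightarrow> ereal \<Rightarrow> ereal \<Rightarrow> ('z::real_normed_vector \<Rightarrow> 'w::real_normed_vector) \<Rightarrow> real \<Rightarrow> bool" where
  "pcn_ineq posZ absZ posW absW p q S C \<longleftrightarrow>
     (\<forall>n z. pinorm posW absW p (\<lambda>i. S (z i)) n \<le> C * absweak posZ absZ q z n)"

definition is_left_pcn where "is_left_pcn pos absv p q S \<longleftrightarrow> (\<exists>C. left_pcn_ineq pos absv p q S C)"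
definition left_pcn_norm where "left_pcn_norm pos absv p q S = Inf {C. 0 \<le> C \<and> left_pcn_ineq pos absv p q S C}"
definition is_right_pcn where "is_right_pcn pos absv p q S \<longleftrightarrow> (\<exists>C. right_pcn_ineq pos absv p q S C)"
definition right_pcn_norm where "right_pcn_norm pos absv p q S = Inf {C. 0 \<le> C \<and> right_pcn_ineq pos absv p q S C}"
definition is_pcn where "is_pcn posZ absZ posW absW p q S \<longleftrightarrow> (\<exists>C. pcn_ineq posZ absZ posW absW p q S C)"
definition pcn_norm where "pcn_norm posZ absZ posW absW p q S = Inf {C. 0 \<le> C \<and> pcn_ineq posZ absZ posW absW p q S C}"

definition adj :: "('a::real_normed_vector \<Rightarrow>\<^sub>L 'b::real_normed_vector) \<Rightarrow> ('b \<Rightarrow>\<^sub>L real) \<Rightarrow> ('a \<Rightarrow>\<^sub>L real)" where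
  "adj T g = g o\<^sub>L T"

abbreviation lpos :: "'a::banach_lattice \<Rightarrow> bool" where "lpos x \<equiv> 0 \<le> x"

end

theory Submission
  imports Defs "HOL-Library.Lattice_Algebras"
begin

text \<open>
  By homogeneity each of the inequalities can be tested on unit balls, where it bounds a pairing of the
  form \<open>\<Sum>i<n. u i (T (z i))\<close>. Two facts make the conditions for \<open>T\<close> and its adjoint symmetric. First, the
  Hahn--Banach theorem for the sublinear functional \<open>x \<mapsto> y |x|\<close> replaces positive functionals acting on
  \<open>|T x|\<close> by arbitrary functionals \<open>u\<close> with \<open>|u| \<le> y\<close> acting on \<open>T x\<close>. Second, a local reflexivity principle
  shows that families in the bidual contribute nothing beyond families in the space itself.
\<close>

section \<open>The Hahn--Banach theorem\<close>

text \<open>The norms of the adjoint quantify over functionals on a dual space, hence over elements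
  of a bidual, while those of \<open>T\<close> see only the space itself. This mismatch occurs in
  three places: in the pi-norm on the dual of a lattice, in the Cohen norm on the dual of a Banach
  space, and in \<open>absweak\<close> on the dual of a lattice, whose test functionals are positive
  elements of the bidual. Local reflexivity bridges the first two. The third is settled by Holder's
  inequality, since the \<open>\<ell>_r\<close> norm of the tested values is the value at one
  norming combination of the given functionals, and the norm of that combination is controlled on
  the space. Every inequality is transferred with its constant \<open>C\<close>, so the sets of
  admissible constants agree and the equality of norms comes along with the equivalence.\<close>

definition sublinear :: "('a::real_vector \<Rightarrow> real) \<Rightarrow> bool" where
  "sublinear p \<longleftrightarrow> (\<forall>x y. p (x + y) \<le> p x + p y) \<and> (\<forall>c x. 0 \<le> c \<longrightarrow> p (c *\<^sub>R x) = c * p x)"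

lemma sublinear_add: "sublinear p \<Longrightarrow> p (x + y) \<le> p x + p y"
  and sublinear_scale: "sublinear p \<Longrightarrow> 0 \<le> c \<Longrightarrow> p (c *\<^sub>R x) = c * p x"
  by (auto simp: sublinear_def)

lemma sublinear_0: "sublinear p \<Longrightarrow> p 0 = 0"
  using sublinear_scale[of p 0 0] by simp

lemma sublinearI:
  assumes "\<And>x y. p (x + y) \<le> p x + p y" and "\<And>c x. 0 < c \<Longrightarrow> p (c *\<^sub>R x) \<le> c * p x" and "p 0 = 0"
  shows "sublinear p"
proof -
  have "c * p x \<le> p (c *\<^sub>R x)" if "0 < c" for c x
    using assms(2)[of "inverse c" "c *\<^sub>R x"] that by (simp add: field_simps)
  with assms(2) have "p (c *\<^sub>R x) = c * p x" if "0 < c" for c x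
    using that by (simp add: order_antisym)
  then show ?thesis
    unfolding sublinear_def using assms(1,3) by (metis less_eq_real_def mult_zero_left scaleR_zero_left)
qed

text \<open>\<open>R x s\<close> is read as a constraint \<open>f x \<le> s\<close> on a linear
  functional \<open>f\<close> to be found. The constraints form a convex cone in the product with
  the real line, and \<open>env\<close> is its lower boundary. \<open>nonneg\<close> is the
  consistency condition: no combination of constraints forces \<open>f 0\<close> below 0.\<close>

locale upper_cone =
  fixes R :: "'a::real_vector \<Rightarrow> real \<Rightarrow> bool"
  assumes add: "R x s \<Longrightarrow> R y t \<Longrightarrow> R (x + y) (s + t)"
    and scale: "0 < c \<Longrightarrow> R x s \<Longrightarrow> R (c *\<^sub>R x) (c * s)"
    and zero: "R 0 0"
    and total: "\<exists>s. R x s"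
    and nonneg: "R 0 s \<Longrightarrow> 0 \<le> s"
begin

definition env :: "'a \<Rightarrow> real" where "env x = Inf {s. R x s}"

text \<open>A constraint at \<open>x\<close> and a fixed one at \<open>- x\<close> add up to a
  constraint at 0, where \<open>nonneg\<close> applies.\<close>

lemma bdd_below: "bdd_below {s. R x s}"
proof -
  obtain t where t: "R (- x) t" using total by blast
  have "- t \<le> s" if "R x s" for s
    using nonneg[of "s + t"] add[OF that t] by simp
  then show ?thesis by (auto simp: bdd_below_def)
qed

lemma env_le: "R x s \<Longrightarrow> env x \<le> s"
  unfolding env_def by (rule cInf_lower) (auto simp: bdd_below)

lemma le_env: "(\<And>s. R x s \<Longrightarrow> b \<le> s) \<Longrightarrow> b \<le> env x"
  unfolding env_def using total by (intro cInf_greatest) auto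

lemma env_sublinear: "sublinear env"
proof (rule sublinearI)
  fix x y
  have "env (x + y) - s \<le> env y" if s: "R x s" for s
    by (rule le_env) (use env_le[OF add[OF s]] in \<open>force simp: algebra_simps\<close>)
  then have "env (x + y) - env y \<le> env x"
    by (intro le_env) (force simp: algebra_simps)
  then show "env (x + y) \<le> env x + env y" by simp
next
  fix c x assume c: "0 < (c::real)"
  have "env (c *\<^sub>R x) / c \<le> env x"
    using env_le[OF scale[OF c]] c by (intro le_env) (auto simp: field_simps)
  then show "env (c *\<^sub>R x) \<le> c * env x" using c by (simp add: field_simps)
next
  show "env 0 = 0" by (intro antisym env_le zero le_env nonneg)
qed

end

text \<open>These are the constraints met by every linear \<open>f\<close> below \<open>q\<close>
  with \<open>f y = q y\<close>, because then \<open>f x = f (x + t *\<^sub>R y) - t * q y\<close>.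
  They are consistent at 0, since \<open>q\<close> is homogeneous along \<open>y\<close>.\<close>

lemma upper_cone_shift:
  assumes q: "sublinear q"
  shows "upper_cone (\<lambda>x s. \<exists>t\<ge>0. q (x + t *\<^sub>R y) - t * q y \<le> s)"
proof
  fix x s x' s'
  assume "\<exists>t\<ge>0. q (x + t *\<^sub>R y) - t * q y \<le> s" "\<exists>t\<ge>0. q (x' + t *\<^sub>R y) - t * q y \<le> s'"
  then obtain t t' where t: "0 \<le> t" "q (x + t *\<^sub>R y) - t * q y \<le> s" "0 \<le> t'" "q (x' + t' *\<^sub>R y) - t' * q y \<le> s'"
    by blast
  have "q ((x + x') + (t + t') *\<^sub>R y) \<le> q (x + t *\<^sub>R y) + q (x' + t' *\<^sub>R y)"
    using sublinear_add[OF q, of "x + t *\<^sub>R y" "x' + t' *\<^sub>R y"] by (simp add: algebra_simps)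
  then show "\<exists>t\<ge>0. q ((x + x') + t *\<^sub>R y) - t * q y \<le> s + s'"
    using t by (intro exI[of _ "t + t'"]) (auto simp: algebra_simps)
next
  fix c x s
  assume c: "0 < (c::real)" and "\<exists>t\<ge>0. q (x + t *\<^sub>R y) - t * q y \<le> s"
  then obtain t where t: "0 \<le> t" "q (x + t *\<^sub>R y) - t * q y \<le> s" by blast
  have "q (c *\<^sub>R x + (c * t) *\<^sub>R y) = c * q (x + t *\<^sub>R y)"
    using sublinear_scale[OF q, of c "x + t *\<^sub>R y"] c by (simp add: algebra_simps)
  then have "q (c *\<^sub>R x + (c * t) *\<^sub>R y) - (c * t) * q y = c * (q (x + t *\<^sub>R y) - t * q y)"
    by (simp add: algebra_simps)
  also have "\<dots> \<le> c * s" using t c by (intro mult_left_mono) auto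
  finally show "\<exists>t\<ge>0. q (c *\<^sub>R x + t *\<^sub>R y) - t * q y \<le> c * s"
    using t c by (intro exI[of _ "c * t"]) auto
qed (use sublinear_0[OF q] sublinear_scale[OF q] in \<open>auto intro: exI[of _ 0]\<close>)

text \<open>A minimal sublinear functional \<open>q\<close> is linear, because \<open>x \<mapsto> inf\<^sub>t (q (x + t y) - t q y)\<close> is
  sublinear and lies below \<open>q\<close>.\<close>

lemma minimal_sublinear_linear:
  assumes q: "sublinear q" and min: "\<And>q'. sublinear q' \<Longrightarrow> (\<And>x. q' x \<le> q x) \<Longrightarrow> q' = q"
  shows "linear q"
proof -
  have add: "q (x + y) = q x + q y" for x y
  proof -
    interpret upper_cone "\<lambda>x s. \<exists>t\<ge>0. q (x + t *\<^sub>R y) - t * q y \<le> s"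
      by (rule upper_cone_shift[OF q])
    have "env = q"
      by (rule min[OF env_sublinear]) (auto intro!: env_le exI[of _ 0])
    \<comment> \<open>The constraint with \<open>t = 1\<close>; once \<open>env = q\<close>, it is
      the converse of subadditivity.\<close>
    moreover have "env x \<le> q (x + y) - q y"
      by (rule env_le) (auto intro!: exI[of _ 1])
    ultimately show ?thesis using sublinear_add[OF q, of x y] by simp
  qed
  show ?thesis
  proof (rule linearI[OF add])
    fix c x
    have neg: "q (- z) = - q z" for z
      using add[of z "- z"] sublinear_0[OF q] by simp
    show "q (c *\<^sub>R x) = c *\<^sub>R q x"
    proof (cases "0 \<le> c")
      case True
      then show ?thesis using sublinear_scale[OF q] by simp
    next
      case False
      then show ?thesis
        using sublinear_scale[OF q, of "- c" x] neg[of "c *\<^sub>R x"] by simp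
    qed
  qed
qed

text \<open>Zorn's lemma runs downwards over the sublinear functionals below \<open>p\<close>, all
  defined on the whole space, so no extension from subspaces takes place.\<close>

theorem hahn_banach_sublinear:
  assumes p: "sublinear p"
  shows "\<exists>f. linear f \<and> (\<forall>x. f x \<le> p x)"
proof -
  define A where "A = {q. sublinear q \<and> (\<forall>x. q x \<le> p x)}"
  have "\<exists>m\<in>A. \<forall>q\<in>A. q \<le> m \<longrightarrow> q = m"
  proof (rule predicate_Zorn)
    show "partial_order_on A (relation_of (\<lambda>x y. y \<le> x) A)"
      by (intro partial_order_on_relation_ofI) auto
    fix C assume "C \<in> Chains (relation_of (\<lambda>x y. y \<le> x) A)"
    then have CA: "C \<subseteq> A" and ch: "\<And>a b. a \<in> C \<Longrightarrow> b \<in> C \<Longrightarrow> a \<le> b \<or> b \<le> a"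
      by (auto simp: Chains_def relation_of_def)
    show "\<exists>u\<in>A. \<forall>a\<in>C. u \<le> a"
    proof (cases "C = {}")
      case True
      then show ?thesis using p by (auto simp: A_def)
    next
      case False
      have sub: "sublinear a" if "a \<in> C" for a using that CA by (auto simp: A_def)
      then have zero: "a 0 = 0" if "a \<in> C" for a using that sublinear_0 by blast
      \<comment> \<open>The envelope of these constraints is the pointwise infimum of the chain. Any
        two members have a member below both, which makes the constraints additive.\<close>
      interpret upper_cone "\<lambda>x s. \<exists>a\<in>C. a x \<le> s"
      proof
        fix x s y t assume "\<exists>a\<in>C. a x \<le> s" "\<exists>a\<in>C. a y \<le> t"
        then obtain a b where ab: "a \<in> C" "b \<in> C" "a x \<le> s" "b y \<le> t" by blast
        obtain d where d: "d \<in> C" "d \<le> a" "d \<le> b" using ch[OF ab(1,2)] ab(1,2) by blast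
        have "d (x + y) \<le> d x + d y" by (rule sublinear_add[OF sub[OF d(1)]])
        also have "\<dots> \<le> s + t" using d ab by (meson add_mono le_funD order_trans)
        finally show "\<exists>a\<in>C. a (x + y) \<le> s + t" using d by blast
      next
        fix x s and c :: real assume "0 < c" "\<exists>a\<in>C. a x \<le> s"
        then obtain a where "a \<in> C" "a x \<le> s" by blast
        with \<open>0 < c\<close> show "\<exists>a\<in>C. a (c *\<^sub>R x) \<le> c * s"
          using sublinear_scale[OF sub, of a c x] by (intro bexI[of _ a]) (auto intro: mult_left_mono)
      qed (use False zero in \<open>fastforce+\<close>)
      have le: "env \<le> a" if "a \<in> C" for a
        using that by (intro le_funI env_le) auto
      moreover obtain a where "a \<in> C" using False by blast
      moreover have "env \<in> A"
        using env_sublinear le[OF \<open>a \<in> C\<close>] \<open>a \<in> C\<close> CA by (auto simp: A_def intro: order_trans dest: le_funD)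
      ultimately show ?thesis by blast
    qed
  qed
  then obtain m where m: "m \<in> A" "\<And>q. q \<in> A \<Longrightarrow> q \<le> m \<Longrightarrow> q = m" by blast
  have "linear m"
  proof (rule minimal_sublinear_linear)
    show "sublinear m" using m by (simp add: A_def)
    show "q = m" if "sublinear q" "\<And>x. q x \<le> m x" for q
      using that m(1) by (intro m(2) le_funI) (auto simp: A_def intro: order_trans)
  qed
  with m show ?thesis by (auto simp: A_def)
qed

corollary (in upper_cone) hahn_banach:
  obtains f where "linear f" and "\<And>x s. R x s \<Longrightarrow> f x \<le> s"
  using hahn_banach_sublinear[OF env_sublinear] env_le by (meson order_trans)

corollary hahn_banach_at:
  assumes p: "sublinear p"
  obtains f where "linear f" and "\<And>x. f x \<le> p x" and "f y = p y"
proof -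
  obtain f where f: "linear f" and le: "\<And>x s. \<exists>t\<ge>0. p (x + t *\<^sub>R y) - t * p y \<le> s \<Longrightarrow> f x \<le> s"
    using upper_cone.hahn_banach[OF upper_cone_shift[OF p, of y]] by blast
  have "f x \<le> p x" for x by (rule le) (auto intro: exI[of _ 0])
  \<comment> \<open>At \<open>- y\<close> the choice \<open>t = 1\<close> gives
    \<open>p 0 - p y\<close>, which forces \<open>f\<close> to touch \<open>p\<close> at
    \<open>y\<close>.\<close>
  moreover have "f (- y) \<le> - p y"
    by (rule le) (use sublinear_0[OF p] in \<open>auto intro: exI[of _ 1]\<close>)
  ultimately show ?thesis
    using that[OF f] linear_neg[OF f, of y] by (metis antisym neg_le_iff_le)
qed

section \<open>Finite sequence norms\<close>

lemma conj_exp_1 [simp]: "conj_exp 1 = \<infinity>" and conj_exp_PInf [simp]: "conj_exp \<infinity> = 1"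
  by (auto simp: conj_exp_def)

lemma conj_exp_real: "1 < s \<Longrightarrow> conj_exp (ereal s) = ereal (s / (s - 1))"
  by (simp add: conj_exp_def)

lemma exponent_cases:
  assumes "1 \<le> (r::ereal)"
  obtains "r = 1" | "r = \<infinity>" | s where "1 < s" "r = ereal s"
  using assms by (cases r) (auto simp: order.order_iff_strict one_ereal_def)

lemma one_le_conj_exp: "1 \<le> r \<Longrightarrow> 1 \<le> conj_exp r"
  by (cases r rule: exponent_cases) (auto simp: conj_exp_real)

lemma conj_exp_conj_exp:
  assumes "1 \<le> r"
  shows "conj_exp (conj_exp r) = r"
  using assms
proof (cases r rule: exponent_cases)
  case (3 s)
  then have "1 < s / (s - 1)" "s / (s - 1) / (s / (s - 1) - 1) = s" by (auto simp: field_simps)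
  then show ?thesis using 3 by (simp add: conj_exp_real)
qed auto

lemma lpn_1: "lpn 1 a n = (\<Sum>i<n. \<bar>a i\<bar>)"
  by (simp add: lpn_def sum_nonneg)

text \<open>The condition \<open>0 \<le> c\<close> comes from the 0 inserted into the supremum and
  matters for the empty family.\<close>

lemma lpn_PInf_le_iff: "lpn \<infinity> a n \<le> c \<longleftrightarrow> 0 \<le> c \<and> (\<forall>i<n. \<bar>a i\<bar> \<le> c)"
  unfolding lpn_def by (subst if_P, simp, subst cSup_le_iff) auto

lemma lpn_nonneg: "0 \<le> lpn r a n"
  using lpn_PInf_le_iff[of a n "lpn \<infinity> a n"] by (cases "r = \<infinity>") (auto simp: lpn_def)

lemma lpn_real_powr: "1 \<le> s \<Longrightarrow> lpn (ereal s) a n powr s = (\<Sum>i<n. \<bar>a i\<bar> powr s)"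
  by (simp add: lpn_def powr_powr sum_nonneg)

lemma abs_le_lpn: "1 \<le> r \<Longrightarrow> i < n \<Longrightarrow> \<bar>a i\<bar> \<le> lpn r a n"
proof (cases "r = \<infinity>")
  case True
  assume "i < n"
  then show ?thesis using lpn_PInf_le_iff[of a n "lpn \<infinity> a n"] True by auto
next
  case False
  assume r: "1 \<le> r" and i: "i < n"
  obtain s where s: "r = ereal s" "1 \<le> s" using r False by (cases r) (auto simp: one_ereal_def)
  have "\<bar>a i\<bar> powr s \<le> (\<Sum>i<n. \<bar>a i\<bar> powr s)"
    using i by (intro member_le_sum) auto
  then have "(\<bar>a i\<bar> powr s) powr (1 / s) \<le> lpn r a n"
    using s by (simp add: lpn_def powr_mono2)
  then show ?thesis using s by (simp add: powr_powr)
qed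

lemma lpn_mono:
  assumes r: "1 \<le> r" and "\<And>i. i < n \<Longrightarrow> \<bar>a i\<bar> \<le> \<bar>b i\<bar>"
  shows "lpn r a n \<le> lpn r b n"
proof (cases "r = \<infinity>")
  case True
  then show ?thesis
    using assms lpn_nonneg[of r b n] abs_le_lpn[OF r, of _ n b]
    by (auto simp: lpn_PInf_le_iff intro: order_trans)
next
  case False
  then obtain s where s: "r = ereal s" "1 \<le> s" using r by (cases r) (auto simp: one_ereal_def)
  then show ?thesis
    using assms(2) by (auto simp: lpn_def intro!: powr_mono2 sum_mono sum_nonneg)
qed

lemma lpn_scale: "1 \<le> r \<Longrightarrow> lpn r (\<lambda>i. c * a i) n = \<bar>c\<bar> * lpn r a n"
proof (cases "r = \<infinity>")
  case True
  have le: "lpn \<infinity> (\<lambda>i. c * a i) n \<le> \<bar>c\<bar> * lpn \<infinity> a n" for c a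
    using abs_le_lpn[of \<infinity> _ n a] lpn_nonneg[of \<infinity> a n]
    by (auto simp: lpn_PInf_le_iff abs_mult intro: mult_left_mono)
  have "\<bar>c\<bar> * lpn \<infinity> a n \<le> lpn \<infinity> (\<lambda>i. c * a i) n"
  proof (cases "c = 0")
    case False
    then show ?thesis using le[of "inverse c" "\<lambda>i. c * a i"]
      by (simp add: field_simps abs_mult abs_inverse)
  qed (simp add: lpn_nonneg)
  with le True show ?thesis by (simp add: antisym)
next
  case False
  assume "1 \<le> r"
  then obtain s where s: "r = ereal s" "1 \<le> s" using False by (cases r) (auto simp: one_ereal_def)
  then have "lpn r (\<lambda>i. c * a i) n = (\<bar>c\<bar> powr s * (\<Sum>i<n. \<bar>a i\<bar> powr s)) powr (1 / s)"
    by (simp add: lpn_def abs_mult powr_mult sum_distrib_left)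
  also have "\<dots> = \<bar>c\<bar> * lpn r a n"
    using s by (simp add: lpn_def powr_mult sum_nonneg powr_powr)
  finally show ?thesis .
qed

lemma lpn_eq_0: "1 \<le> r \<Longrightarrow> lpn r a n = 0 \<Longrightarrow> i < n \<Longrightarrow> a i = 0"
  using abs_le_lpn[of r i n a] by simp

lemma sum_normalized_powr:
  assumes "1 \<le> s" "lpn (ereal s) a n \<noteq> 0"
  shows "(\<Sum>i<n. (\<bar>a i\<bar> / lpn (ereal s) a n) powr s) = 1"
proof -
  let ?A = "lpn (ereal s) a n"
  have "?A powr s \<noteq> 0" using assms by simp
  moreover have "(\<Sum>i<n. (\<bar>a i\<bar> / ?A) powr s) = (\<Sum>i<n. \<bar>a i\<bar> powr s) / ?A powr s"
    by (simp add: powr_divide lpn_nonneg sum_divide_distrib)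
  ultimately show ?thesis using assms(1) by (simp add: lpn_real_powr)
qed

text \<open>Young's inequality for the entries divided by their norms. A vanishing norm kills all
  products, and the two endpoint exponents share one estimate with the factors exchanged.\<close>

lemma Holder_lpn:
  assumes r: "1 \<le> r"
  shows "(\<Sum>i<n. a i * b i) \<le> lpn r a n * lpn (conj_exp r) b n"
proof -
  have one: "(\<Sum>i<n. a i * b i) \<le> lpn 1 a n * lpn \<infinity> b n" for a b
  proof -
    have "a i * b i \<le> \<bar>a i\<bar> * lpn \<infinity> b n" if "i < n" for i
    proof -
      have "a i * b i \<le> \<bar>a i\<bar> * \<bar>b i\<bar>" by (metis abs_ge_self abs_mult)
      also have "\<dots> \<le> \<bar>a i\<bar> * lpn \<infinity> b n" using that by (intro mult_left_mono abs_le_lpn) auto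
      finally show ?thesis .
    qed
    then show ?thesis unfolding lpn_1 sum_distrib_right by (intro sum_mono) auto
  qed
  show ?thesis using r
  proof (cases r rule: exponent_cases)
    case 1
    then show ?thesis using one by simp
  next
    case 2
    then show ?thesis using one[of b a] by (simp add: mult.commute)
  next
    case (3 s)
    define t where "t = s / (s - 1)"
    have t: "1 < t" "1 / s + 1 / t = 1" "conj_exp r = ereal t"
      using 3 by (auto simp: t_def conj_exp_real field_simps)
    define A B where "A = lpn r a n" and "B = lpn (conj_exp r) b n"
    have r': "1 \<le> conj_exp r" using r by (rule one_le_conj_exp)
    show ?thesis
    proof (cases "A = 0 \<or> B = 0")
      case True
      then have "a i * b i = 0" if "i < n" for i
        using lpn_eq_0[OF r _ that, of a] lpn_eq_0[OF r' _ that, of b] by (auto simp: A_def B_def)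
      then show ?thesis using lpn_nonneg by (simp add: sum.neutral)
    next
      case False
      then have AB: "0 < A" "0 < B"
        using lpn_nonneg[of r a n] lpn_nonneg[of "conj_exp r" b n] by (auto simp: A_def B_def)
      have "a i * b i \<le> A * B * ((\<bar>a i\<bar> / A) powr s / s + (\<bar>b i\<bar> / B) powr t / t)" for i
      proof -
        have "a i * b i \<le> \<bar>a i\<bar> * \<bar>b i\<bar>" by (metis abs_ge_self abs_mult)
        also have "\<dots> = A * B * ((\<bar>a i\<bar> / A) * (\<bar>b i\<bar> / B))" using AB by simp
        also have "\<dots> \<le> A * B * ((\<bar>a i\<bar> / A) powr s / s + (\<bar>b i\<bar> / B) powr t / t)"
          using AB 3 t by (intro mult_left_mono Youngs_inequality) auto
        finally show ?thesis .
      qed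
      then have "(\<Sum>i<n. a i * b i) \<le> A * B * ((\<Sum>i<n. (\<bar>a i\<bar> / A) powr s) / s + (\<Sum>i<n. (\<bar>b i\<bar> / B) powr t) / t)"
        by (simp add: sum_mono sum_distrib_left sum_divide_distrib flip: sum.distrib)
      also have "\<dots> = A * B"
        using sum_normalized_powr[of s a n] sum_normalized_powr[of t b n] 3 t False
        by (simp add: A_def B_def)
      finally show ?thesis by (simp add: A_def B_def)
    qed
  qed
qed

text \<open>The norming vector is explicit: signs for \<open>r = 1\<close>, a single signed
  coordinate for \<open>r = \<infinity>\<close>, signed powers with exponent \<open>s - 1\<close> in
  between. Its entries inherit nonnegativity from \<open>b\<close>, so that it can later be used as
  coefficients of positive functionals.\<close>

lemma lpn_attained:
  assumes r: "1 \<le> r"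
  obtains a where "lpn (conj_exp r) a n \<le> 1" "(\<Sum>i<n. a i * b i) = lpn r b n"
    "\<And>i. 0 \<le> b i \<Longrightarrow> 0 \<le> a i"
  using r
proof (cases r rule: exponent_cases)
  case 1
  then show ?thesis
    using that[of "\<lambda>i. sgn (b i)"]
    by (auto simp: lpn_PInf_le_iff lpn_1 abs_sgn_eq mult.commute[of "sgn _"] simp flip: abs_sgn)
next
  case 2
  show ?thesis
  proof (cases "n = 0")
    case True
    then show ?thesis using 2 that[of "\<lambda>_. 0"] by (simp add: lpn_def)
  next
    case False
    have "lpn \<infinity> b n \<in> insert 0 ((\<lambda>i. \<bar>b i\<bar>) ` {..<n})"
      unfolding lpn_def by (simp add: cSup_eq_Max del: Max_insert)
        (metis Max_in finite.insertI finite_imageI finite_lessThan insert_iff insert_not_empty)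
    \<comment> \<open>The maximum may be the inserted 0; then all entries vanish and, as
      \<open>n\<close> is positive, index 0 attains it.\<close>
    moreover have "\<exists>i<n. lpn \<infinity> b n = \<bar>b i\<bar>" if "lpn \<infinity> b n = 0"
      using lpn_eq_0[OF _ that, of 0] that False by auto
    ultimately obtain k where k: "k < n" "lpn \<infinity> b n = \<bar>b k\<bar>" by auto
    show ?thesis
    proof (rule that[of "\<lambda>i. if i = k then sgn (b k) else 0"])
      show "lpn (conj_exp r) (\<lambda>i. if i = k then sgn (b k) else 0) n \<le> 1"
        using 2 k by (simp add: lpn_1 if_distrib abs_sgn_eq cong: if_cong)
      show "(\<Sum>i<n. (if i = k then sgn (b k) else 0) * b i) = lpn r b n"
        using 2 k by (simp add: if_distrib[of "\<lambda>x. x * _"] abs_sgn mult.commute[of "sgn _"] cong: if_cong)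
    qed auto
  qed
next
  case (3 s)
  define t where "t = s / (s - 1)"
  have t: "1 < t" "conj_exp r = ereal t" "(s - 1) * t = s"
    using 3 by (auto simp: t_def conj_exp_real field_simps)
  define B where "B = lpn r b n"
  show ?thesis
  proof (cases "B = 0")
    case True
    then show ?thesis using that[of "\<lambda>_. 0"] t by (simp add: B_def lpn_def)
  next
    case False
    then have B: "0 < B" using lpn_nonneg[of r b n] by (auto simp: B_def)
    have one: "(\<Sum>i<n. (\<bar>b i\<bar> / B) powr s) = 1"
      using sum_normalized_powr[of s b n] 3 False by (simp add: B_def)
    show ?thesis
    proof (rule that[of "\<lambda>i. sgn (b i) * (\<bar>b i\<bar> / B) powr (s - 1)"])
      have "\<bar>sgn (b i) * (\<bar>b i\<bar> / B) powr (s - 1)\<bar> powr t = (\<bar>b i\<bar> / B) powr s" for i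
        using t by (cases "b i = 0") (simp_all add: abs_mult abs_sgn_eq powr_powr)
      then show "lpn (conj_exp r) (\<lambda>i. sgn (b i) * (\<bar>b i\<bar> / B) powr (s - 1)) n \<le> 1"
        using one t by (simp add: lpn_def)
      have "sgn (b i) * (\<bar>b i\<bar> / B) powr (s - 1) * b i = B * (\<bar>b i\<bar> / B) powr s" for i
      proof (cases "b i = 0")
        case False
        define x where "x = \<bar>b i\<bar> / B"
        have x: "0 < x" "\<bar>b i\<bar> = B * x" using B False by (auto simp: x_def)
        have "sgn (b i) * x powr (s - 1) * b i = x powr (s - 1) * \<bar>b i\<bar>"
          by (simp add: abs_sgn)
        also have "\<dots> = B * (x powr (s - 1) * x powr 1)" using x by simp
        also have "\<dots> = B * x powr s"
          using powr_add[of x "s - 1" 1] by (simp only: diff_add_cancel)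
        finally show ?thesis by (simp only: x_def)
      qed simp
      then show "(\<Sum>i<n. sgn (b i) * (\<bar>b i\<bar> / B) powr (s - 1) * b i) = lpn r b n"
        using one by (simp add: B_def flip: sum_distrib_left)
    qed (auto simp: sgn_if)
  qed
qed

text \<open>The entries of a norming vector are at most 1 in absolute value. This bound makes the
  suprema in the weak norms finite.\<close>

lemma lpn_le_sum:
  assumes r: "1 \<le> r"
  shows "lpn r b n \<le> (\<Sum>i<n. \<bar>b i\<bar>)"
proof -
  obtain a where a: "lpn (conj_exp r) a n \<le> 1" "(\<Sum>i<n. a i * b i) = lpn r b n"
    using lpn_attained[OF r] by metis
  have "a i * b i \<le> \<bar>b i\<bar>" if "i < n" for i
  proof -
    have "\<bar>a i\<bar> \<le> 1" using abs_le_lpn[OF one_le_conj_exp[OF r] that, of a] a by simp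
    then have "\<bar>a i\<bar> * \<bar>b i\<bar> \<le> 1 * \<bar>b i\<bar>" by (intro mult_right_mono) auto
    then show ?thesis using abs_ge_self[of "a i * b i"] by (simp add: abs_mult)
  qed
  then show ?thesis unfolding a(2)[symmetric] by (intro sum_mono) auto
qed

text \<open>Rounding the norming vector towards zero to multiples of \<open>1 / M\<close> keeps it in the unit ball and
  costs at most \<open>n / M\<close> times \<open>lpn r b n\<close>.\<close>

lemma finite_norming_set:
  assumes r: "1 \<le> r" and \<delta>: "0 < (\<delta>::real)"
  obtains N a where "\<And>k. k < N \<Longrightarrow> lpn (conj_exp r) (a k) n \<le> 1"
    "\<And>b. \<exists>k<(N::nat). (1 - \<delta>) * lpn r b n \<le> (\<Sum>i<n. a k i * b i)"
proof -
  \<comment> \<open>This gives \<open>n / M < \<delta>\<close>, which absorbs the total rounding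
    error over \<open>n\<close> coordinates.\<close>
  obtain M :: nat where M: "real n / \<delta> < real M" using reals_Archimedean2 by blast
  then have M0: "0 < real M" using \<delta> by (meson divide_nonneg_pos le_less_trans of_nat_0_le_iff)
  \<comment> \<open>The grid consists of functions that are \<open>undefined\<close> off
    \<open>{..<n}\<close>, since only then is it finite; \<open>d\<close> below is restricted for
    the same reason.\<close>
  define A where "A = {a \<in> {..<n} \<rightarrow>\<^sub>E (\<lambda>j. real_of_int j / real M) ` {- int M..int M}. lpn (conj_exp r) a n \<le> 1}"
  have "finite A" unfolding A_def
    by (rule finite_subset[of _ "{..<n} \<rightarrow>\<^sub>E (\<lambda>j. real_of_int j / real M) ` {- int M..int M}"])
      (auto intro!: finite_PiE)
  then obtain N and a :: "nat \<Rightarrow> nat \<Rightarrow> real" where Na: "A = a ` {i. i < N}"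
    using finite_imp_nat_seg_image_inj_on by blast
  show ?thesis
  proof (rule that[of N a])
    show "lpn (conj_exp r) (a k) n \<le> 1" if "k < N" for k
      using that Na by (auto simp: A_def)
    fix b
    obtain c where c: "lpn (conj_exp r) c n \<le> 1" "(\<Sum>i<n. c i * b i) = lpn r b n"
      using lpn_attained[OF r] by metis
    define d where "d = (\<lambda>i\<in>{..<n}. of_int ((if 0 \<le> c i then 1 else - 1) * \<lfloor>\<bar>c i\<bar> * M\<rfloor>) / real M)"
    have fl: "of_int \<lfloor>\<bar>c i\<bar> * M\<rfloor> \<le> \<bar>c i\<bar> * M" "\<bar>c i\<bar> * M - 1 \<le> of_int \<lfloor>\<bar>c i\<bar> * M\<rfloor>" for i
      by linarith+
    have fl0: "0 \<le> \<lfloor>\<bar>c i\<bar> * M\<rfloor>" for i by simp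
    have fl0': "0 \<le> real_of_int \<lfloor>\<bar>c i\<bar> * M\<rfloor>" for i using fl0 of_int_0_le_iff by blast
    have absd: "\<bar>d i\<bar> = of_int \<lfloor>\<bar>c i\<bar> * M\<rfloor> / M" if "i < n" for i
      using that abs_of_nonneg[OF fl0'[of i]] by (simp add: d_def abs_mult)
    have le: "\<bar>d i\<bar> \<le> \<bar>c i\<bar>" if "i < n" for i
      using absd[OF that] M0 by (simp add: pos_divide_le_eq)
    have close: "\<bar>c i - d i\<bar> \<le> 1 / M" if "i < n" for i
    proof -
      define u where "u = real_of_int \<lfloor>\<bar>c i\<bar> * M\<rfloor> / M"
      have "u \<le> \<bar>c i\<bar>" using M0 by (simp add: u_def pos_divide_le_eq)
      moreover have "\<bar>c i\<bar> - 1 / M \<le> u"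
        using divide_right_mono[OF fl(2)[of i], of M] M0 by (simp add: u_def diff_divide_distrib)
      moreover have "d i = (if 0 \<le> c i then u else - u)" using that by (simp add: d_def u_def)
      ultimately show ?thesis by (auto split: if_splits)
    qed
    have dn: "lpn (conj_exp r) d n \<le> 1"
      using lpn_mono[OF one_le_conj_exp[OF r], of n d c] le c(1) by simp
    have "d i \<in> (\<lambda>j. real_of_int j / real M) ` {- int M..int M}" if "i < n" for i
    proof -
      have "\<bar>c i\<bar> \<le> 1" using abs_le_lpn[OF one_le_conj_exp[OF r] that, of c] c by simp
      then have "\<bar>c i\<bar> * M \<le> real_of_int (int M)" by (simp add: mult_left_le_one_le)
      then have "\<lfloor>\<bar>c i\<bar> * M\<rfloor> \<le> int M" by linarith
      then have "(if 0 \<le> c i then 1 else - 1) * \<lfloor>\<bar>c i\<bar> * M\<rfloor> \<in> {- int M..int M}"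
        using fl0[of i] by (auto simp del: zero_le_floor)
      then have "(\<lambda>j. real_of_int j / real M) ((if 0 \<le> c i then 1 else - 1) * \<lfloor>\<bar>c i\<bar> * M\<rfloor>)
        \<in> (\<lambda>j. real_of_int j / real M) ` {- int M..int M}" by (rule imageI)
      then show ?thesis using that by (simp only: d_def restrict_apply' lessThan_iff)
    qed
    then have "d \<in> A" using dn by (auto simp: A_def d_def)
    then obtain k where k: "k < N" "d = a k" using Na by blast
    have "(c i - d i) * b i \<le> \<bar>b i\<bar> / M" if "i < n" for i
    proof -
      have "(c i - d i) * b i \<le> \<bar>c i - d i\<bar> * \<bar>b i\<bar>" by (metis abs_ge_self abs_mult)
      also have "\<dots> \<le> 1 / M * \<bar>b i\<bar>" using close[OF that] by (intro mult_right_mono) auto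
      finally show ?thesis by simp
    qed
    then have "(\<Sum>i<n. (c i - d i) * b i) \<le> (\<Sum>i<n. lpn r b n / M)"
      using abs_le_lpn[OF r, of _ n b] M0
      by (intro sum_mono) (meson divide_right_mono lessThan_iff of_nat_0_le_iff order_trans)
    also have "\<dots> = real n / M * lpn r b n" by simp
    also have "\<dots> \<le> \<delta> * lpn r b n"
      using M M0 \<delta> by (intro mult_right_mono lpn_nonneg) (simp add: field_simps)
    finally have "(1 - \<delta>) * lpn r b n \<le> (\<Sum>i<n. d i * b i)"
      using c(2) by (simp add: left_diff_distrib sum_subtractf)
    then show "\<exists>k<N. (1 - \<delta>) * lpn r b n \<le> (\<Sum>i<n. a k i * b i)" using k by blast
  qed
qed

section \<open>Banach lattices and their duals\<close>

instance banach_lattice \<subseteq> lattice_ab_group_add ..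

lemma labs_le_iff: "labs x \<le> y \<longleftrightarrow> x \<le> y \<and> - x \<le> y"
  by (simp add: labs_def)

lemma le_labs: "x \<le> labs x" and minus_le_labs: "- x \<le> labs x"
  by (simp_all add: labs_def)

lemma labs_nonneg [simp]: "0 \<le> labs x"
  using add_mono[OF le_labs[of x] minus_le_labs[of x]] by simp

lemma labs_of_nonneg: "0 \<le> x \<Longrightarrow> labs x = x"
  unfolding labs_def by (rule sup_absorb1) (metis neg_le_0_iff_le order_trans)

lemma labs_labs [simp]: "labs (labs x) = labs x"
  by (simp add: labs_of_nonneg)

lemma labs_0 [simp]: "labs 0 = 0"
  by (simp add: labs_of_nonneg)

lemma labs_minus [simp]: "labs (- x) = labs x"
  by (simp add: labs_def sup_commute)

lemma labs_add_le: "labs (x + y) \<le> labs x + labs y"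
  unfolding labs_le_iff
  using add_mono[OF le_labs[of x] le_labs[of y]] add_mono[OF minus_le_labs[of x] minus_le_labs[of y]]
  by simp

lemma labs_scaleR_le: "0 \<le> c \<Longrightarrow> labs (c *\<^sub>R x) \<le> c *\<^sub>R labs x"
  unfolding labs_le_iff
  using scaleR_left_mono[OF le_labs[of x], of c] scaleR_left_mono[OF minus_le_labs[of x], of c] by simp

lemma labs_scaleR:
  assumes "0 < c"
  shows "labs (c *\<^sub>R x) = c *\<^sub>R labs x"
proof (rule antisym)
  show "labs (c *\<^sub>R x) \<le> c *\<^sub>R labs x" using assms by (simp add: labs_scaleR_le)
  have "labs (inverse c *\<^sub>R c *\<^sub>R x) \<le> inverse c *\<^sub>R labs (c *\<^sub>R x)"
    using assms by (intro labs_scaleR_le) simp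
  then have "c *\<^sub>R labs x \<le> c *\<^sub>R inverse c *\<^sub>R labs (c *\<^sub>R x)"
    using assms by (intro scaleR_left_mono) auto
  then show "c *\<^sub>R labs x \<le> labs (c *\<^sub>R x)" using assms by simp
qed

lemma norm_mono_labs: "labs x \<le> labs y \<Longrightarrow> norm x \<le> norm y"
  unfolding labs_def by (rule norm_lattice_mono)

lemma norm_labs [simp]: "norm (labs x) = norm x"
  by (intro antisym norm_mono_labs) simp_all

lemma norm_mono_of_labs_le: "labs x \<le> y \<Longrightarrow> norm x \<le> norm y"
  by (rule norm_mono_labs) (metis labs_nonneg labs_of_nonneg order_trans)

lemma pprt_diff_pprt: "x = pprt x - pprt (- x)" for x :: "'a::banach_lattice"
  using prts[of x] pprt_neg[of x] by simp

lemma pprt_add_le: "pprt (x + y) \<le> pprt x + pprt y" for x :: "'a::banach_lattice"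
  unfolding pprt_def by (simp add: add_mono add_nonneg_nonneg)

lemma le_pprt: "x \<le> pprt x" for x :: "'a::banach_lattice"
  by (simp add: pprt_def)

lemma pprt_of_nonneg: "0 \<le> x \<Longrightarrow> pprt x = x" for x :: "'a::banach_lattice"
  by (simp add: pprt_def sup_absorb1)

lemma pprt_scaleR_le: "0 \<le> c \<Longrightarrow> pprt (c *\<^sub>R x) \<le> c *\<^sub>R pprt x" for x :: "'a::banach_lattice"
  using scaleR_left_mono[OF le_pprt[of x], of c]
  unfolding pprt_def[of "c *\<^sub>R x"] by (simp add: scaleR_nonneg_nonneg)

lemma pprt_le_labs: "pprt x \<le> labs x"
  by (simp add: pprt_def le_labs)

lemma norm_mono_nonneg: "0 \<le> x \<Longrightarrow> x \<le> y \<Longrightarrow> norm x \<le> norm y" for x :: "'a::banach_lattice"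
  by (rule norm_mono_of_labs_le) (simp add: labs_of_nonneg)

lemma norm_pprt_le: "norm (pprt x) \<le> norm x" for x :: "'a::banach_lattice"
  using norm_mono_nonneg[OF zero_le_pprt pprt_le_labs] by simp

text \<open>The linear functionals below this gauge are exactly the positive ones in the dual unit
  ball, as \<open>le_norm_pprt_iff\<close> shows. One sublinear functional thus encodes both
  positivity and the norm bound.\<close>

lemma sublinear_norm_pprt: "sublinear (\<lambda>x :: 'a::banach_lattice. norm (pprt x))"
proof (rule sublinearI)
  fix x y :: 'a
  show "norm (pprt (x + y)) \<le> norm (pprt x) + norm (pprt y)"
    using norm_mono_nonneg[OF zero_le_pprt pprt_add_le] norm_triangle_ineq order_trans by blast
next
  fix c :: real and x :: 'a assume "0 < c"
  then show "norm (pprt (c *\<^sub>R x)) \<le> c * norm (pprt x)"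
    using norm_mono_nonneg[OF zero_le_pprt pprt_scaleR_le[of c x]] by simp
qed (simp add: pprt_def)

text \<open>\<open>u\<close> is \<open>y\<close> truncated to the order interval from
  \<open>- a\<close> to \<open>a\<close>; the two-sided bound on \<open>y\<close> puts the remainder
  between \<open>- b\<close> and \<open>b\<close>.\<close>

lemma Riesz_decomposition:
  fixes y :: "'a::banach_lattice"
  assumes "labs y \<le> a + b" "0 \<le> a" "0 \<le> b"
  obtains u v where "y = u + v" "labs u \<le> a" "labs v \<le> b"
proof
  define u where "u = sup (- a) (inf y a)"
  have y: "y \<le> a + b" "- y \<le> a + b" using assms(1) by (simp_all add: labs_le_iff)
  have "- a \<le> a" using assms(2) by (metis neg_le_0_iff_le order_trans)
  then have "u \<le> a" by (simp add: u_def)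
  moreover have "- a \<le> u" by (simp add: u_def)
  ultimately show "labs u \<le> a" by (simp add: labs_le_iff minus_le_iff)
  have "y - b \<le> u"
  proof -
    have "y - b \<le> inf y a" using y assms by (simp add: algebra_simps)
    then show ?thesis by (simp add: u_def le_supI2)
  qed
  moreover have "u \<le> y + b"
  proof -
    have "- a \<le> y + b"
      using add_right_mono[OF y(2), of "y - a"] by (simp add: algebra_simps)
    moreover have "inf y a \<le> y + b" using assms(3) by (simp add: le_infI1)
    ultimately show ?thesis by (simp add: u_def)
  qed
  ultimately show "labs (y - u) \<le> b" by (simp add: labs_le_iff algebra_simps)
  show "y = u + (y - u)" by simp
qed

text \<open>The one-sided bound is two-sided by linearity, which is the form in which domination by
  a sublinear functional arrives.\<close>

lemma Blinfun_exists:
  fixes f :: "'a::real_normed_vector \<Rightarrow> real"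
  assumes f: "linear f" and le: "\<And>x. f x \<le> K * norm x" and "0 \<le> K"
  obtains F :: "'a \<Rightarrow>\<^sub>L real" where "\<And>x. blinfun_apply F x = f x" "norm F \<le> K"
proof -
  have abs: "\<bar>f x\<bar> \<le> K * norm x" for x
    using le[of x] le[of "- x"] linear_neg[OF f, of x] by simp
  have "bounded_linear f"
    by (rule bounded_linear_intro[of _ K])
      (use f abs in \<open>auto simp: linear_add linear_cmul mult.commute\<close>)
  then have F: "blinfun_apply (Blinfun f) x = f x" for x by (simp add: bounded_linear_Blinfun_apply)
  then have "norm (Blinfun f) \<le> K" using abs assms(3) by (intro norm_blinfun_bound) auto
  with F show ?thesis by (rule that)
qed

lemma blinfun_apply_le: "blinfun_apply f x \<le> norm f * norm x" for f :: "'a::real_normed_vector \<Rightarrow>\<^sub>L real"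
  using norm_blinfun[of f x] by simp

section \<open>The Riesz-Kantorovich modulus of a functional\<close>

lemma dpos_mono: "dpos f \<Longrightarrow> x \<le> y \<Longrightarrow> f x \<le> f y"
  unfolding dpos_def using blinfun.diff_right[of f y x] by (metis diff_ge_0_iff_ge)

text \<open>The formula is studied as a function on the cone first, because \<open>dabs\<close> is a
  choice and its values are known only after a functional with these values has been
  constructed.\<close>

definition modulus_on_cone :: "('a::banach_lattice \<Rightarrow>\<^sub>L real) \<Rightarrow> 'a \<Rightarrow> real" where
  "modulus_on_cone f x = Sup {\<bar>f y\<bar> | y. labs y \<le> x}"

lemma abs_apply_le_of_labs_le: "labs y \<le> x \<Longrightarrow> \<bar>f y\<bar> \<le> norm f * norm x"
  for f :: "'a::banach_lattice \<Rightarrow>\<^sub>L real"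
  using norm_blinfun[of f y] mult_left_mono[OF norm_mono_of_labs_le, of y x "norm f"] by simp

lemma le_modulus_on_cone: "labs y \<le> x \<Longrightarrow> \<bar>blinfun_apply f y\<bar> \<le> modulus_on_cone f x"
  unfolding modulus_on_cone_def
  by (rule cSup_upper) (auto simp: bdd_above_def intro: abs_apply_le_of_labs_le)

lemma modulus_on_cone_le: "0 \<le> x \<Longrightarrow> (\<And>y. labs y \<le> x \<Longrightarrow> blinfun_apply f y \<le> c) \<Longrightarrow> modulus_on_cone f x \<le> c"
  unfolding modulus_on_cone_def
proof (rule cSup_least)
  assume "0 \<le> x" then show "{\<bar>f y\<bar> | y. labs y \<le> x} \<noteq> {}" by (auto intro: exI[of _ 0])
next
  fix z assume c: "\<And>y. labs y \<le> x \<Longrightarrow> f y \<le> c" and "z \<in> {\<bar>f y\<bar> | y. labs y \<le> x}"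
  then obtain y where y: "z = \<bar>f y\<bar>" "labs y \<le> x" by blast
  with c[of y] c[of "- y"] show "z \<le> c" by (simp add: blinfun.minus_right)
qed

lemma modulus_on_cone_add:
  assumes "0 \<le> a" "0 \<le> b"
  shows "modulus_on_cone f (a + b) = modulus_on_cone f a + modulus_on_cone f b"
proof (rule antisym)
  show "modulus_on_cone f (a + b) \<le> modulus_on_cone f a + modulus_on_cone f b"
  proof (rule modulus_on_cone_le)
    fix y assume "labs y \<le> a + b"
    then obtain u v where "y = u + v" "labs u \<le> a" "labs v \<le> b"
      using Riesz_decomposition assms by metis
    then show "f y \<le> modulus_on_cone f a + modulus_on_cone f b"
      using le_modulus_on_cone[of u a f] le_modulus_on_cone[of v b f] by (simp add: blinfun.add_right)
  qed (use assms in simp)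
  \<comment> \<open>For superadditivity the supremum is taken over \<open>v\<close> with
    \<open>u\<close> fixed, and afterwards over \<open>u\<close>.\<close>
  have "f u + f v \<le> modulus_on_cone f (a + b)" if "labs u \<le> a" "labs v \<le> b" for u v
    using le_modulus_on_cone[OF order_trans[OF labs_add_le add_mono[OF that]], of f]
    by (simp add: blinfun.add_right)
  then have "f v \<le> modulus_on_cone f (a + b) - f u" if "labs u \<le> a" "labs v \<le> b" for u v
    using that by (simp add: algebra_simps)
  then have "modulus_on_cone f b \<le> modulus_on_cone f (a + b) - f u" if "labs u \<le> a" for u
    using that assms by (intro modulus_on_cone_le)
  then have "modulus_on_cone f a \<le> modulus_on_cone f (a + b) - modulus_on_cone f b"
    using assms by (intro modulus_on_cone_le) (force simp: algebra_simps)+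
  then show "modulus_on_cone f a + modulus_on_cone f b \<le> modulus_on_cone f (a + b)" by simp
qed

lemma modulus_on_cone_scaleR:
  assumes "0 \<le> x" "0 < c"
  shows "modulus_on_cone f (c *\<^sub>R x) = c * modulus_on_cone f x"
proof -
  have le: "modulus_on_cone f (c *\<^sub>R x) \<le> c * modulus_on_cone f x" if "0 \<le> x" "0 < c" for c x
  proof (rule modulus_on_cone_le)
    fix y assume "labs y \<le> c *\<^sub>R x"
    then have "inverse c *\<^sub>R labs y \<le> inverse c *\<^sub>R c *\<^sub>R x"
      using that by (intro scaleR_left_mono) auto
    then have "labs (inverse c *\<^sub>R y) \<le> x"
      using that labs_scaleR_le[of "inverse c" y] by simp
    then show "f y \<le> c * modulus_on_cone f x"
      using le_modulus_on_cone[of "inverse c *\<^sub>R y" x f] that by (simp add: blinfun.scaleR_right field_simps)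
  qed (use that in \<open>simp add: scaleR_nonneg_nonneg\<close>)
  show ?thesis
    using le[OF assms] le[of "c *\<^sub>R x" "inverse c"] assms
    by (simp add: scaleR_nonneg_nonneg field_simps)
qed

text \<open>The modulus is additive and positively homogeneous on the cone, so it extends to
  differences of positive elements. The extension \<open>g\<close> is the witness for the choice in
  \<open>dabs\<close>.\<close>

lemma dabs_apply:
  assumes "0 \<le> x"
  shows "dabs f x = modulus_on_cone f x"
proof -
  let ?m = "modulus_on_cone f"
  define g where "g x = ?m (pprt x) - ?m (pprt (- x))" for x
  \<comment> \<open>The value does not depend on how an element is written as a difference of
    positive ones. Linearity then follows without computing the positive part of a sum.\<close>
  have g_diff: "g (a - b) = ?m a - ?m b" if "0 \<le> a" "0 \<le> b" for a b
  proof -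
    have "?m (a + pprt (- (a - b))) = ?m (b + pprt (a - b))"
      using pprt_diff_pprt[of "a - b"] by (simp add: algebra_simps)
    then show ?thesis using that by (simp add: g_def modulus_on_cone_add)
  qed
  have m0: "?m 0 = 0" using modulus_on_cone_add[of 0 0 f] by simp
  have g_cone: "g x = ?m x" if "0 \<le> x" for x using g_diff[of x 0] that m0 by simp
  have g_add: "g (x + y) = g x + g y" for x y
  proof -
    have "x + y = (pprt x + pprt y) - (pprt (- x) + pprt (- y))"
      unfolding add_diff_add by (simp flip: pprt_diff_pprt)
    then have "g (x + y) = ?m (pprt x + pprt y) - ?m (pprt (- x) + pprt (- y))"
      using g_diff by (metis add_nonneg_nonneg zero_le_pprt)
    then show ?thesis by (simp add: modulus_on_cone_add g_def)
  qed
  have g_pos: "g (c *\<^sub>R x) = c * g x" if "0 < c" for c x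
  proof -
    have "c *\<^sub>R x = c *\<^sub>R pprt x - c *\<^sub>R pprt (- x)"
      using pprt_diff_pprt[of x] by (metis scaleR_right_diff_distrib)
    then have "g (c *\<^sub>R x) = ?m (c *\<^sub>R pprt x) - ?m (c *\<^sub>R pprt (- x))"
      using g_diff that by (metis scaleR_nonneg_nonneg less_imp_le zero_le_pprt)
    then show ?thesis using that by (simp add: modulus_on_cone_scaleR g_def algebra_simps)
  qed
  have g_neg: "g (- x) = - g x" for x by (simp add: g_def)
  have "linear g"
  proof (rule linearI[OF g_add])
    fix c x
    show "g (c *\<^sub>R x) = c *\<^sub>R g x"
      using g_pos[of c x] g_pos[of "- c" x] g_neg[of "c *\<^sub>R x"] g_cone[of 0] m0
      by (cases "c = 0"; cases "0 < c") auto
  qed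
  moreover have "g x \<le> norm f * norm x" for x
  proof -
    have "?m (pprt x) \<le> norm f * norm (pprt x)"
      by (rule modulus_on_cone_le) (use abs_apply_le_of_labs_le[of _ "pprt x" f] in \<open>force+\<close>)
    also have "\<dots> \<le> norm f * norm x" by (intro mult_left_mono norm_pprt_le) simp
    finally have "?m (pprt x) \<le> norm f * norm x" .
    moreover have "0 \<le> ?m (pprt (- x))"
      using le_modulus_on_cone[of 0 "pprt (- x)" f] by simp
    ultimately show ?thesis by (simp add: g_def)
  qed
  ultimately obtain G :: "'a \<Rightarrow>\<^sub>L real" where G: "\<And>x. blinfun_apply G x = g x"
    using Blinfun_exists by (metis norm_ge_zero)
  have "\<forall>x. 0 \<le> x \<longrightarrow> blinfun_apply (dabs f) x = Sup {\<bar>f y\<bar> | y. labs y \<le> x}"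
    unfolding dabs_def
    by (rule someI[of _ G]) (simp add: G g_cone flip: modulus_on_cone_def)
  then show ?thesis using assms by (simp add: modulus_on_cone_def)
qed

lemma abs_apply_le_dabs: "\<bar>blinfun_apply f x\<bar> \<le> dabs f (labs x)"
  using le_modulus_on_cone[of x "labs x" f] by (simp add: dabs_apply)

lemma dabs_apply_le:
  assumes "0 \<le> x" "\<And>y. labs y \<le> x \<Longrightarrow> blinfun_apply f y \<le> c"
  shows "dabs f x \<le> c"
  using modulus_on_cone_le[OF assms] assms(1) by (simp add: dabs_apply)

lemma dpos_dabs: "dpos (dabs f)"
  unfolding dpos_def using abs_apply_le_dabs[of f] by (metis abs_ge_zero labs_of_nonneg order_trans)

text \<open>Domination by the norm of the positive part, in place of the norm, makes the Hahn-Banach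
  functional positive: at \<open>- x\<close> with \<open>0 \<le> x\<close> the bound is 0.\<close>

lemma norming_functional:
  fixes v :: "'a::banach_lattice"
  obtains u where "dpos u" "norm u \<le> 1" "blinfun_apply u (labs v) = norm v"
proof -
  obtain f where f: "linear f" "\<And>x :: 'a. f x \<le> norm (pprt x)" "f (labs v) = norm (pprt (labs v))"
    using hahn_banach_at[OF sublinear_norm_pprt] by blast
  have "f x \<le> 1 * norm x" for x using f(2)[of x] norm_pprt_le[of x] by simp
  then obtain F :: "'a \<Rightarrow>\<^sub>L real" where F: "\<And>x. blinfun_apply F x = f x" "norm F \<le> 1"
    using Blinfun_exists[OF f(1), of 1] by auto
  have "0 \<le> f x" if "0 \<le> x" for x
  proof -
    have "pprt (- x) = 0" using that by (simp add: pprt_def sup_absorb2)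
    then show ?thesis using f(2)[of "- x"] linear_neg[OF f(1), of x] by simp
  qed
  then show ?thesis using that[of F] F f(3) by (simp add: dpos_def pprt_of_nonneg)
qed

lemma modulus_attained:
  fixes y :: "'a::banach_lattice \<Rightarrow>\<^sub>L real"
  assumes y: "dpos y"
  obtains u :: "'a \<Rightarrow>\<^sub>L real" where "\<And>x. \<bar>u x\<bar> \<le> y (labs x)" "u v = y (labs v)"
proof -
  have "sublinear (\<lambda>x. y (labs x))"
  proof (rule sublinearI)
    show "y (labs (a + b)) \<le> y (labs a) + y (labs b)" for a b
      using dpos_mono[OF y labs_add_le] by (simp add: blinfun.add_right)
    show "y (labs (c *\<^sub>R x)) \<le> c * y (labs x)" if "0 < c" for c x
      using that by (simp add: labs_scaleR blinfun.scaleR_right)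
  qed (simp add: blinfun.zero_right)
  then obtain f where f: "linear f" "\<And>x. f x \<le> y (labs x)" "f v = y (labs v)"
    using hahn_banach_at by blast
  have "f x \<le> norm y * norm x" for x using f(2)[of x] blinfun_apply_le[of y "labs x"] by simp
  then obtain F :: "'a \<Rightarrow>\<^sub>L real" where F: "\<And>x. blinfun_apply F x = f x"
    using Blinfun_exists[OF f(1)] by (metis norm_ge_zero)
  have "\<bar>f x\<bar> \<le> y (labs x)" for x
    using f(2)[of x] f(2)[of "- x"] linear_neg[OF f(1), of x] by simp
  then show ?thesis using that[of F] F f(3) by simp
qed

section \<open>Local reflexivity for weakly summable families\<close>

text \<open>Used to normalise by a quantity \<open>t\<close> that may be 0: one divides by some
  \<open>s > t\<close> and lets \<open>s\<close> decrease to \<open>t\<close>.\<close>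

lemma le_mult_of_greater:
  fixes x D t :: real
  assumes "0 \<le> D" "\<And>s. t < s \<Longrightarrow> x \<le> D * s"
  shows "x \<le> D * t"
proof (rule field_le_epsilon)
  fix e :: real assume e: "0 < e"
  have "x \<le> D * (t + e / (D + 1))" using assms e by simp
  also have "\<dots> \<le> D * t + e" using assms(1) e by (simp add: field_simps)
  finally show "x \<le> D * t + e" .
qed

text \<open>Hahn-Banach is to be applied to a space of families \<open>(x k)\<close>. Bounded
  continuous functions on the discrete space \<open>nat\<close> are the bounded sequences, and this
  map embeds the \<open>k\<close>-th coordinate.\<close>

definition coord_bcontfun :: "nat \<Rightarrow> 'a::real_normed_vector \<Rightarrow> nat \<Rightarrow>\<^sub>C 'a" where
  "coord_bcontfun k x = Bcontfun (\<lambda>j. if j = k then x else 0)"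

lemma coord_bcontfun_apply: "apply_bcontfun (coord_bcontfun k x) j = (if j = k then x else 0)"
proof -
  have "(\<lambda>j. if j = k then x else 0) \<in> bcontfun"
    by (rule bcontfun_normI[of _ "norm x"]) auto
  then show ?thesis by (simp add: coord_bcontfun_def Bcontfun_inverse)
qed

lemma linear_coord_bcontfun: "linear (coord_bcontfun k)"
  by (rule linearI; rule bcontfun_eqI) (auto simp: coord_bcontfun_apply)

lemma apply_bcontfun_sum: "apply_bcontfun (\<Sum>k\<in>A. y k) j = (\<Sum>k\<in>A. apply_bcontfun (y k) j)"
  by (induction A rule: infinite_finite_induct) auto

text \<open>The functionals below \<open>\<nu>\<close> serve as test ball and \<open>K\<close> is
  the cone in which families vary. The two uses are the norm of the positive part with the positive
  cone, and the norm with the whole space.\<close>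

locale dominated_functionals =
  fixes \<nu> :: "'e::real_normed_vector \<Rightarrow> real" and K :: "'e set"
  assumes sublinear: "sublinear \<nu>" and nonneg: "0 \<le> \<nu> x" and le_norm: "\<nu> x \<le> norm x"
    and K0: "0 \<in> K" and K_add: "x \<in> K \<Longrightarrow> y \<in> K \<Longrightarrow> x + y \<in> K"
    and K_scale: "0 < c \<Longrightarrow> x \<in> K \<Longrightarrow> c *\<^sub>R x \<in> K"
begin

text \<open>Let \<open>A\<close> send a family \<open>z\<close> to the finite family of the
  \<open>(\<Sum>i<n. a k i *\<^sub>R z i)\<close>. By \<open>bound\<close>, \<open>g\<close> is at
  most \<open>C\<close> times the largest \<open>\<nu>\<close> of the entries of \<open>A z\<close>.
  Hahn-Banach on the target of \<open>A\<close> yields \<open>\<phi>\<close> of dual size at most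
  \<open>C\<close> with \<open>g\<close> below \<open>\<phi>\<close> composed with \<open>A\<close>;
  on a cone there is domination in place of equality.\<close>

lemma finite_decomposition:
  fixes g :: "nat \<Rightarrow> 'e \<Rightarrow>\<^sub>L real" and a :: "nat \<Rightarrow> nat \<Rightarrow> real"
  assumes C: "0 \<le> C"
    and bound: "\<And>z t. (\<And>i. z i \<in> K) \<Longrightarrow> 0 \<le> t \<Longrightarrow> (\<And>k. k < N \<Longrightarrow> \<nu> (\<Sum>i<n. a k i *\<^sub>R z i) \<le> t)
      \<Longrightarrow> (\<Sum>i<n. g i (z i)) \<le> C * t"
  obtains \<phi> :: "nat \<Rightarrow> 'e \<Rightarrow>\<^sub>L real" where
    "\<And>x t. 0 \<le> t \<Longrightarrow> (\<And>k. k < N \<Longrightarrow> \<nu> (x k) \<le> t) \<Longrightarrow> (\<Sum>k<N. \<phi> k (x k)) \<le> C * t"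
    "\<And>i z. i < n \<Longrightarrow> z \<in> K \<Longrightarrow> g i z \<le> (\<Sum>k<N. a k i * \<phi> k z)"
proof -
  \<comment> \<open>The sought \<open>f\<close> is to satisfy \<open>f y \<le> C * t\<close>
    whenever \<open>t\<close> bounds \<open>\<nu>\<close> on the entries of \<open>y\<close>, and
    \<open>f (A z) \<ge> g z\<close> on \<open>K\<close>. Subtracting the second from the first at
    \<open>y + A z\<close> gives these constraints.\<close>
  define R :: "(nat \<Rightarrow>\<^sub>C 'e) \<Rightarrow> real \<Rightarrow> bool" where
    "R y s \<longleftrightarrow> (\<exists>t z. 0 \<le> t \<and> (\<forall>i. z i \<in> K) \<and> (\<forall>k<N. \<nu> (apply_bcontfun y k + (\<Sum>i<n. a k i *\<^sub>R z i)) \<le> t)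
      \<and> C * t - (\<Sum>i<n. g i (z i)) \<le> s)" for y s
  have RI: "R y s" if "0 \<le> t" "\<And>i. z i \<in> K" "\<And>k. k < N \<Longrightarrow> \<nu> (apply_bcontfun y k + (\<Sum>i<n. a k i *\<^sub>R z i)) \<le> t"
    "C * t - (\<Sum>i<n. g i (z i)) \<le> s" for y s t z
    unfolding R_def using that by blast
  have RE: thesis if "R y s" "\<And>t z. 0 \<le> t \<Longrightarrow> (\<And>i. z i \<in> K) \<Longrightarrow>
    (\<And>k. k < N \<Longrightarrow> \<nu> (apply_bcontfun y k + (\<Sum>i<n. a k i *\<^sub>R z i)) \<le> t) \<Longrightarrow>
    C * t - (\<Sum>i<n. g i (z i)) \<le> s \<Longrightarrow> thesis" for y s thesis
    using that unfolding R_def by blast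
  have R0: "R y (C * t)" if "0 \<le> t" "\<And>k. k < N \<Longrightarrow> \<nu> (apply_bcontfun y k) \<le> t" for y t
    by (rule RI[where z = "\<lambda>_. 0" and t = t]) (use that K0 in \<open>auto simp: blinfun.zero_right\<close>)
  interpret upper_cone R
  proof
    fix x y s s' assume "R x s" "R y s'"
    from this(1) obtain t z where 1: "0 \<le> t" "\<And>i. z i \<in> K"
      "\<And>k. k < N \<Longrightarrow> \<nu> (apply_bcontfun x k + (\<Sum>i<n. a k i *\<^sub>R z i)) \<le> t" "C * t - (\<Sum>i<n. g i (z i)) \<le> s"
      by (rule RE) blast
    from \<open>R y s'\<close> obtain t' z' where 2: "0 \<le> t'" "\<And>i. z' i \<in> K"
      "\<And>k. k < N \<Longrightarrow> \<nu> (apply_bcontfun y k + (\<Sum>i<n. a k i *\<^sub>R z' i)) \<le> t'" "C * t' - (\<Sum>i<n. g i (z' i)) \<le> s'"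
      by (rule RE) blast
    show "R (x + y) (s + s')"
    proof (rule RI[where z = "\<lambda>i. z i + z' i" and t = "t + t'"])
      fix k assume k: "k < N"
      have "apply_bcontfun (x + y) k + (\<Sum>i<n. a k i *\<^sub>R (z i + z' i)) =
        (apply_bcontfun x k + (\<Sum>i<n. a k i *\<^sub>R z i)) + (apply_bcontfun y k + (\<Sum>i<n. a k i *\<^sub>R z' i))"
        by (simp add: scaleR_add_right sum.distrib)
      then show "\<nu> (apply_bcontfun (x + y) k + (\<Sum>i<n. a k i *\<^sub>R (z i + z' i))) \<le> t + t'"
        using order_trans[OF sublinear_add[OF sublinear] add_mono[OF 1(3)[OF k] 2(3)[OF k]]] by (simp only:)
    next
      have "C * (t + t') - (\<Sum>i<n. g i (z i + z' i)) = (C * t - (\<Sum>i<n. g i (z i))) + (C * t' - (\<Sum>i<n. g i (z' i)))"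
        by (simp add: blinfun.add_right sum.distrib distrib_left)
      then show "C * (t + t') - (\<Sum>i<n. g i (z i + z' i)) \<le> s + s'"
        using add_mono[OF 1(4) 2(4)] by (simp only:)
    next
      show "z i + z' i \<in> K" for i by (intro K_add 1 2)
    qed (use 1 2 in simp)
  next
    fix c x s assume c: "0 < (c::real)" and "R x s"
    from this(2) obtain t z where 1: "0 \<le> t" "\<And>i. z i \<in> K"
      "\<And>k. k < N \<Longrightarrow> \<nu> (apply_bcontfun x k + (\<Sum>i<n. a k i *\<^sub>R z i)) \<le> t" "C * t - (\<Sum>i<n. g i (z i)) \<le> s"
      by (rule RE) blast
    show "R (c *\<^sub>R x) (c * s)"
    proof (rule RI[where z = "\<lambda>i. c *\<^sub>R z i" and t = "c * t"])
      fix k assume k: "k < N"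
      have "apply_bcontfun (c *\<^sub>R x) k + (\<Sum>i<n. a k i *\<^sub>R (c *\<^sub>R z i)) = c *\<^sub>R (apply_bcontfun x k + (\<Sum>i<n. a k i *\<^sub>R z i))"
        by (simp add: scaleR_add_right scaleR_sum_right mult.commute)
      then show "\<nu> (apply_bcontfun (c *\<^sub>R x) k + (\<Sum>i<n. a k i *\<^sub>R (c *\<^sub>R z i))) \<le> c * t"
        using c 1(3)[OF k] by (simp add: sublinear_scale[OF sublinear])
    next
      have "C * (c * t) - (\<Sum>i<n. g i (c *\<^sub>R z i)) = c * (C * t - (\<Sum>i<n. g i (z i)))"
        by (simp add: blinfun.scaleR_right sum_distrib_left algebra_simps)
      then show "C * (c * t) - (\<Sum>i<n. g i (c *\<^sub>R z i)) \<le> c * s"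
        using 1(4) c by simp
    next
      show "c *\<^sub>R z i \<in> K" for i by (intro K_scale 1 c)
    qed (use 1 c in simp)
  next
    show "R 0 0" using R0[of 0 0] sublinear_0[OF sublinear] by simp
  next
    fix y :: "nat \<Rightarrow>\<^sub>C 'e"
    show "\<exists>s. R y s"
      using R0[of "norm y" y] le_norm norm_bounded[of y] by (meson norm_ge_zero order_trans)
  next
    \<comment> \<open>Consistency of the constraints at 0 is exactly the hypothesis
      \<open>bound\<close>.\<close>
    fix s assume "R 0 s"
    from this obtain t z where "0 \<le> t" "\<And>i. z i \<in> K"
      "\<And>k. k < N \<Longrightarrow> \<nu> (\<Sum>i<n. a k i *\<^sub>R z i) \<le> t" "C * t - (\<Sum>i<n. g i (z i)) \<le> s"
      by (rule RE) auto
    with bound[of z t] show "0 \<le> s" by simp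
  qed
  obtain f where f: "linear f" and fR: "\<And>y s. R y s \<Longrightarrow> f y \<le> s" by (rule hahn_banach) blast
  have "\<exists>\<phi> :: 'e \<Rightarrow>\<^sub>L real. \<forall>x. blinfun_apply \<phi> x = f (coord_bcontfun k x)" for k
  proof -
    have "linear (\<lambda>x. f (coord_bcontfun k x))"
      using linear_compose[OF linear_coord_bcontfun f] by (simp add: o_def)
    moreover have "f (coord_bcontfun k x) \<le> C * norm x" for x
      by (rule fR, rule R0) (use le_norm[of x] sublinear_0[OF sublinear] in \<open>auto simp: coord_bcontfun_apply\<close>)
    ultimately show ?thesis using Blinfun_exists C by metis
  qed
  then obtain \<phi> :: "nat \<Rightarrow> 'e \<Rightarrow>\<^sub>L real" where \<phi>: "\<And>k x. \<phi> k x = f (coord_bcontfun k x)" by metis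
  define emb where "emb x = (\<Sum>k<N. coord_bcontfun k (x k))" for x :: "nat \<Rightarrow> 'e"
  have emb: "apply_bcontfun (emb x) k = x k" if "k < N" for x k
    using that by (simp add: emb_def apply_bcontfun_sum coord_bcontfun_apply)
  have sum: "(\<Sum>k<N. \<phi> k (x k)) = f (emb x)" for x
    by (simp add: \<phi> emb_def linear_sum[OF f])
  show ?thesis
  proof
    show "(\<Sum>k<N. \<phi> k (x k)) \<le> C * t" if "0 \<le> t" "\<And>k. k < N \<Longrightarrow> \<nu> (x k) \<le> t" for x t
      unfolding sum by (rule fR, rule R0) (use that in \<open>auto simp: emb\<close>)
    fix i z assume i: "i < n" and z: "z \<in> K"
    \<comment> \<open>The argument is minus the image of the family with single entry
      \<open>z\<close> at place \<open>i\<close>. The two cancel, so \<open>t = 0\<close> is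
      admissible.\<close>
    have "f (emb (\<lambda>k. - (a k i *\<^sub>R z))) \<le> - g i z"
    proof (rule fR, rule RI[where t = 0 and z = "\<lambda>j. if j = i then z else 0"])
      fix k assume "k < N"
      have "(\<Sum>j<n. a k j *\<^sub>R (if j = i then z else 0)) = a k i *\<^sub>R z"
        using i by (simp add: if_distrib cong: if_cong)
      then show "\<nu> (apply_bcontfun (emb (\<lambda>k. - (a k i *\<^sub>R z))) k + (\<Sum>j<n. a k j *\<^sub>R (if j = i then z else 0))) \<le> 0"
        using \<open>k < N\<close> sublinear_0[OF sublinear] by (simp add: emb)
    next
      have "(\<Sum>j<n. g j (if j = i then z else 0)) = (\<Sum>j<n. if j = i then g i z else 0)"
        by (rule sum.cong) (auto simp: blinfun.zero_right)
      then show "C * 0 - (\<Sum>j<n. g j (if j = i then z else 0)) \<le> - g i z" using i by simp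
    qed (use z K0 in auto)
    then show "g i z \<le> (\<Sum>k<N. a k i * \<phi> k z)"
      by (simp flip: sum add: blinfun.minus_right blinfun.scaleR_right sum_negf)
  qed
qed

text \<open>A local reflexivity principle: it suffices to test on the space itself. A finite set
  norming \<open>\<ell>\<^sub>r\<^sup>n\<close> up to a factor \<open>\<theta>\<close> lets the functional \<open>(g i)\<close> be dominated on \<open>K\<close> through
  finitely many \<open>\<phi> k\<close> in norm, so that no weak-star limits (to which \<open>G i\<close> is blind) are involved.\<close>

theorem bidual_weakly_summable:
  fixes g :: "nat \<Rightarrow> 'e \<Rightarrow>\<^sub>L real" and G :: "nat \<Rightarrow> ('e \<Rightarrow>\<^sub>L real) \<Rightarrow>\<^sub>L real"
  assumes r: "1 \<le> r" and C: "0 \<le> C"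
    and bound: "\<And>z. (\<And>i. z i \<in> K) \<Longrightarrow>
      (\<And>\<phi> :: 'e \<Rightarrow>\<^sub>L real. (\<And>x. \<phi> x \<le> \<nu> x) \<Longrightarrow> lpn r (\<lambda>i. \<phi> (z i)) n \<le> 1) \<Longrightarrow> (\<Sum>i<n. g i (z i)) \<le> C"
    and G_pos: "\<And>i h. i < n \<Longrightarrow> (\<And>z. z \<in> K \<Longrightarrow> 0 \<le> blinfun_apply h z) \<Longrightarrow> 0 \<le> G i h"
    and G_le: "\<And>\<phi>. (\<And>x. blinfun_apply \<phi> x \<le> \<nu> x) \<Longrightarrow> lpn r (\<lambda>i. G i \<phi>) n \<le> 1"
  shows "(\<Sum>i<n. G i (g i)) \<le> C"
proof (rule field_le_mult_one_interval)
  fix \<theta> :: real assume \<theta>: "0 < \<theta>" "\<theta> < 1"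
  have r': "1 \<le> conj_exp r" "conj_exp (conj_exp r) = r"
    using r by (auto simp: one_le_conj_exp conj_exp_conj_exp)
  obtain N a where a: "\<And>k. k < N \<Longrightarrow> lpn (conj_exp r) (a k) n \<le> 1"
    "\<And>b. \<exists>k<(N::nat). \<theta> * lpn r b n \<le> (\<Sum>i<n. a k i * b i)"
    using finite_norming_set[OF r, of "1 - \<theta>" n] \<theta> by (metis diff_diff_eq2 add_diff_cancel_left' diff_gt_0_iff_gt)
  \<comment> \<open>The finite set norms only up to the factor \<open>\<theta>\<close>, so testing
    on it costs \<open>1 / \<theta>\<close>; the factor is recovered at the end by letting
    \<open>\<theta>\<close> tend to 1.\<close>
  define D where "D = C / \<theta>"
  have D: "0 \<le> D" using C \<theta> by (simp add: D_def)
  have bound': "(\<Sum>i<n. g i (z i)) \<le> D * t"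
    if z: "\<And>i. z i \<in> K" and t: "0 \<le> t" "\<And>k. k < N \<Longrightarrow> \<nu> (\<Sum>i<n. a k i *\<^sub>R z i) \<le> t" for z t
  proof (rule le_mult_of_greater[OF D])
    fix s assume s: "t < s"
    \<comment> \<open>Scaling by \<open>\<theta> / s\<close> brings the family into the weak unit
      ball: some \<open>a k\<close> detects its norm up to \<open>\<theta>\<close>, and the detected
      value is at most \<open>t < s\<close>.\<close>
    have "(\<Sum>i<n. g i ((\<theta> / s) *\<^sub>R z i)) \<le> C"
    proof (rule bound)
      show "(\<theta> / s) *\<^sub>R z i \<in> K" for i using z \<theta> s t by (intro K_scale) auto
      fix \<phi> :: "'e \<Rightarrow>\<^sub>L real" assume \<phi>: "\<And>x. \<phi> x \<le> \<nu> x"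
      obtain k where k: "k < N" "\<theta> * lpn r (\<lambda>i. \<phi> (z i)) n \<le> (\<Sum>i<n. a k i * \<phi> (z i))"
        using a(2) by blast
      note k(2)
      also have "(\<Sum>i<n. a k i * \<phi> (z i)) = \<phi> (\<Sum>i<n. a k i *\<^sub>R z i)"
        by (simp add: blinfun.sum_right blinfun.scaleR_right)
      also have "\<dots> \<le> t" using \<phi> t(2)[OF k(1)] order_trans by blast
      also have "\<dots> \<le> s" using s by simp
      finally show "lpn r (\<lambda>i. \<phi> ((\<theta> / s) *\<^sub>R z i)) n \<le> 1"
        using s t \<theta> lpn_scale[OF r, of "\<theta> / s" "\<lambda>i. \<phi> (z i)" n] by (simp add: blinfun.scaleR_right)
    qed
    then have "(\<theta> / s) * (\<Sum>i<n. g i (z i)) \<le> C"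
      by (simp add: blinfun.scaleR_right sum_distrib_left)
    then show "(\<Sum>i<n. g i (z i)) \<le> D * s"
      using s t \<theta> by (simp add: D_def field_simps)
  qed
  obtain \<phi> :: "nat \<Rightarrow> 'e \<Rightarrow>\<^sub>L real" where
    \<phi>: "\<And>x t. 0 \<le> t \<Longrightarrow> (\<And>k. k < N \<Longrightarrow> \<nu> (x k) \<le> t) \<Longrightarrow> (\<Sum>k<N. \<phi> k (x k)) \<le> D * t"
    and g: "\<And>i z. i < n \<Longrightarrow> z \<in> K \<Longrightarrow> g i z \<le> (\<Sum>k<N. a k i * \<phi> k z)"
    by (rule finite_decomposition[OF D, where n = n and N = N and a = a and g = g]) (use bound' in blast)+
  \<comment> \<open>\<open>c k\<close> is the dual norm of \<open>\<phi> k\<close> with respect to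
    \<open>\<nu>\<close>, that is, the least constant with
    \<open>\<phi> k \<le> c k * \<nu>\<close>.\<close>
  define c where "c k = (SUP x\<in>{x. \<nu> x \<le> 1}. \<phi> k x)" for k
  have zero: "0 \<in> {x. \<nu> x \<le> 1}" using sublinear_0[OF sublinear] by simp
  have bdd: "bdd_above ((\<lambda>x. \<phi> k x) ` {x. \<nu> x \<le> 1})" if k: "k < N" for k
  proof -
    have "\<phi> k x \<le> D" if "\<nu> x \<le> 1" for x
    proof -
      have "(\<Sum>j<N. \<phi> j (if j = k then x else 0)) = (\<Sum>j<N. if j = k then \<phi> k x else 0)"
        by (rule sum.cong) (auto simp: blinfun.zero_right)
      then show ?thesis
        using \<phi>[of 1 "\<lambda>j. if j = k then x else 0"] that k sublinear_0[OF sublinear] by simp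
    qed
    then show ?thesis by (auto simp: bdd_above_def)
  qed
  have c_upper: "\<phi> k x \<le> c k" if "k < N" "\<nu> x \<le> 1" for k x
    unfolding c_def using bdd[OF that(1)] that(2) by (intro cSUP_upper) auto
  have c_nonneg: "0 \<le> c k" if "k < N" for k
    using c_upper[OF that, of 0] zero by (simp add: blinfun.zero_right)
  have dom: "\<phi> k x \<le> c k * \<nu> x" if k: "k < N" for k x
  proof (rule le_mult_of_greater[OF c_nonneg[OF k]])
    fix s assume s: "\<nu> x < s"
    then have s0: "0 < s" using nonneg[of x] by simp
    then have "\<nu> (inverse s *\<^sub>R x) \<le> 1"
      using s by (simp add: sublinear_scale[OF sublinear] field_simps)
    from c_upper[OF k this] show "\<phi> k x \<le> c k * s"
      using s0 by (simp add: blinfun.scaleR_right field_simps)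
  qed
  have G_c: "lpn r (\<lambda>i. G i (\<phi> k)) n \<le> c k" if k: "k < N" for k
  proof -
    have "lpn r (\<lambda>i. G i (\<phi> k)) n \<le> 1 * d" if d: "c k < d" for d
    proof -
      have d0: "0 < d" using d c_nonneg[OF k] by simp
      have "inverse d *\<^sub>R \<phi> k x \<le> \<nu> x" for x
      proof -
        have "\<phi> k x \<le> d * \<nu> x"
          using dom[OF k, of x] mult_right_mono[of "c k" d "\<nu> x"] d nonneg[of x] by simp
        then show ?thesis using d0 by (simp add: field_simps)
      qed
      then have "lpn r (\<lambda>i. G i (inverse d *\<^sub>R \<phi> k)) n \<le> 1"
        by (intro G_le) (simp add: blinfun.scaleR_left)
      moreover have "lpn r (\<lambda>i. G i (inverse d *\<^sub>R \<phi> k)) n = inverse d * lpn r (\<lambda>i. G i (\<phi> k)) n"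
        using d0 lpn_scale[OF r, of "inverse d" "\<lambda>i. G i (\<phi> k)" n] by (simp add: blinfun.scaleR_right)
      ultimately have "inverse d * lpn r (\<lambda>i. G i (\<phi> k)) n \<le> 1" by (simp only:)
      then show ?thesis using d0 by (simp add: field_simps)
    qed
    then show ?thesis using le_mult_of_greater[of 1 "c k"] by simp
  qed
  \<comment> \<open>The dual of a maximum norm is a sum norm: near-maximisers \<open>x k\<close> can
    be chosen independently and tested together as one family.\<close>
  have sum_c: "(\<Sum>k<N. c k) \<le> D"
  proof -
    have "(\<Sum>k<N. c k) \<le> D + real N * e" if e: "0 < e" for e
    proof -
      have "\<exists>x. \<nu> x \<le> 1 \<and> c k - e < \<phi> k x" if "k < N" for k
        using less_cSUP_iff[OF _ bdd[OF that], of "c k - e"] zero e unfolding c_def by fastforce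
      then obtain x where x: "\<And>k. k < N \<Longrightarrow> \<nu> (x k) \<le> 1" "\<And>k. k < N \<Longrightarrow> c k - e < \<phi> k (x k)" by metis
      have "(\<Sum>k<N. c k - e) \<le> (\<Sum>k<N. \<phi> k (x k))" using x(2) by (intro sum_mono) force
      also have "\<dots> \<le> D" using \<phi>[of 1 x] x(1) by simp
      finally show ?thesis by (simp add: sum_subtractf)
    qed
    note approx = this
    have "(\<Sum>k<N. c k) - D \<le> real N * 0"
      by (rule le_mult_of_greater) (use approx in \<open>simp_all add: diff_le_eq add.commute\<close>)
    then show ?thesis by simp
  qed
  \<comment> \<open>Domination on \<open>K\<close> passes to the bidual because \<open>G i\<close>
    is positive on functionals that are nonnegative on \<open>K\<close>.\<close>
  have "(\<Sum>i<n. G i (g i)) \<le> (\<Sum>i<n. G i (\<Sum>k<N. a k i *\<^sub>R \<phi> k))"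
  proof (rule sum_mono)
    fix i assume "i \<in> {..<n}"
    then have "0 \<le> G i ((\<Sum>k<N. a k i *\<^sub>R \<phi> k) - g i)"
      using g by (intro G_pos) (auto simp: blinfun.diff_left blinfun.sum_left blinfun.scaleR_left)
    then show "G i (g i) \<le> G i (\<Sum>k<N. a k i *\<^sub>R \<phi> k)" by (simp add: blinfun.diff_right)
  qed
  \<comment> \<open>After the exchange of sums, Holder's inequality for fixed \<open>k\<close>
    separates \<open>a k\<close> from the values \<open>G i (\<phi> k)\<close>, which are controlled
    by \<open>c k\<close>.\<close>
  also have "\<dots> = (\<Sum>k<N. \<Sum>i<n. a k i * G i (\<phi> k))"
    by (subst sum.swap) (simp add: blinfun.sum_right blinfun.scaleR_right)
  also have "\<dots> \<le> (\<Sum>k<N. c k)"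
  proof (rule sum_mono)
    fix k assume "k \<in> {..<N}"
    then have k: "k < N" by simp
    have "(\<Sum>i<n. a k i * G i (\<phi> k)) \<le> lpn (conj_exp r) (a k) n * lpn r (\<lambda>i. G i (\<phi> k)) n"
      using Holder_lpn[OF r'(1)] r'(2) by metis
    also have "\<dots> \<le> 1 * c k" using a(1)[OF k] G_c[OF k] by (intro mult_mono lpn_nonneg) auto
    finally show "(\<Sum>i<n. a k i * G i (\<phi> k)) \<le> c k" by simp
  qed
  also note sum_c
  finally show "\<theta> * (\<Sum>i<n. G i (g i)) \<le> C" using \<theta> by (simp add: D_def field_simps)
qed

end

section \<open>The sequence norms\<close>

definition eval_at :: "'a::real_normed_vector \<Rightarrow> ('a \<Rightarrow>\<^sub>L real) \<Rightarrow>\<^sub>L real" where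
  "eval_at x = Blinfun (\<lambda>f. blinfun_apply f x)"

lemma eval_at_apply [simp]: "blinfun_apply (eval_at x) f = blinfun_apply f x"
  by (simp add: eval_at_def bounded_linear_Blinfun_apply blinfun.bounded_linear_left)

lemma eval_at_add: "eval_at (x + y) = eval_at x + eval_at y"
  by (rule blinfun_eqI) (simp add: blinfun.add_right blinfun.add_left)

lemma eval_at_scaleR: "eval_at (c *\<^sub>R x) = c *\<^sub>R eval_at x"
  by (rule blinfun_eqI) (simp add: blinfun.scaleR_right blinfun.scaleR_left)

lemma norm_eval_at_le: "norm (eval_at x) \<le> norm x"
  by (rule norm_blinfun_bound) (simp_all, metis mult.commute norm_blinfun real_norm_def)

lemma norm_le_1_iff: "norm \<phi> \<le> 1 \<longleftrightarrow> (\<forall>x. blinfun_apply \<phi> x \<le> norm x)"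
  for \<phi> :: "'a::real_normed_vector \<Rightarrow>\<^sub>L real"
proof
  assume "norm \<phi> \<le> 1"
  then show "\<forall>x. \<phi> x \<le> norm x"
    using blinfun_apply_le[of \<phi>] mult_right_mono[of "norm \<phi>" 1] norm_ge_zero by (metis mult_1 order_trans)
next
  assume le: "\<forall>x. \<phi> x \<le> norm x"
  have "\<bar>\<phi> x\<bar> \<le> norm x" for x
    using le[rule_format, of x] le[rule_format, of "- x"] by (simp add: blinfun.minus_right)
  then show "norm \<phi> \<le> 1" by (intro norm_blinfun_bound) auto
qed

lemma lpn_apply_le_sum_norm:
  fixes x :: "nat \<Rightarrow> 'a::real_normed_vector" and \<phi> :: "'a \<Rightarrow>\<^sub>L real"
  assumes "1 \<le> r" "norm \<phi> \<le> 1"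
  shows "lpn r (\<lambda>i. \<phi> (x i)) n \<le> (\<Sum>i<n. norm (x i))"
proof -
  have "\<bar>\<phi> y\<bar> \<le> norm y" for y
    using assms(2) norm_le_1_iff[of \<phi>] by (metis abs_le_iff blinfun.minus_right norm_minus_cancel)
  then show ?thesis using lpn_le_sum[OF assms(1)] by (meson order_trans sum_mono)
qed

lemma lpn_uminus: "1 \<le> r \<Longrightarrow> lpn r (\<lambda>i. - a i) n = lpn r a n"
  by (intro antisym lpn_mono) auto

text \<open>A real supremum is meaningful only for a nonempty set that is bounded above: the zero
  functional provides an element and the sum of the norms a bound.\<close>

lemma wnorm_le_iff:
  fixes x :: "nat \<Rightarrow> 'a::real_normed_vector"
  assumes r: "1 \<le> r"
  shows "wnorm r x n \<le> c \<longleftrightarrow> (\<forall>\<phi> :: 'a \<Rightarrow>\<^sub>L real. norm \<phi> \<le> 1 \<longrightarrow> lpn r (\<lambda>i. blinfun_apply \<phi> (x i)) n \<le> c)"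
  unfolding wnorm_def
  by (subst cSup_le_iff)
    (auto simp: bdd_above_def intro: lpn_apply_le_sum_norm[OF r] exI[of _ 0])

lemma absweak_le_iff:
  fixes z :: "nat \<Rightarrow> 'a::real_normed_vector"
  assumes r: "1 \<le> r"
  shows "absweak pos absv r z n \<le> c \<longleftrightarrow>
    (\<forall>\<phi> :: 'a \<Rightarrow>\<^sub>L real. norm \<phi> \<le> 1 \<longrightarrow> posfun pos \<phi> \<longrightarrow> lpn r (\<lambda>i. blinfun_apply \<phi> (absv (z i))) n \<le> c)"
proof -
  have "posfun pos 0" by (simp add: posfun_def)
  then show ?thesis
    unfolding absweak_def
    by (subst cSup_le_iff)
      (auto simp: bdd_above_def intro: lpn_apply_le_sum_norm[OF r] exI[of _ 0])
qed

lemma wnorm_nonneg: "1 \<le> r \<Longrightarrow> 0 \<le> wnorm r x n"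
  using wnorm_le_iff[of r x n "wnorm r x n"] lpn_nonneg order_trans
  by (metis norm_zero zero_le_one order_refl)

lemma absweak_nonneg: "1 \<le> r \<Longrightarrow> 0 \<le> absweak pos absv r z n"
  using absweak_le_iff[of r pos absv z n "absweak pos absv r z n"] lpn_nonneg order_trans
  by (metis norm_zero zero_le_one order_refl posfun_def blinfun.zero_left)

lemma wnorm_uminus: "1 \<le> r \<Longrightarrow> wnorm r (\<lambda>i. - x i) n = wnorm r x n"
  unfolding wnorm_def by (simp add: blinfun.minus_right lpn_uminus)

lemma wnorm_scaleR_le:
  assumes r: "1 \<le> r" and t: "0 < t"
  shows "wnorm r (\<lambda>i. t *\<^sub>R x i) n \<le> t * wnorm r x n"
  unfolding wnorm_le_iff[OF r]
  using t wnorm_le_iff[OF r, of x n "wnorm r x n"] by (simp add: blinfun.scaleR_right lpn_scale[OF r])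

text \<open>The weak norm on a dual space tests with the bidual, which contains the evaluations at
  points of the unit ball.\<close>

lemma norm_le_1_of_wnorm_le_1:
  fixes xs :: "nat \<Rightarrow> 'a::real_normed_vector \<Rightarrow>\<^sub>L real"
  assumes r: "1 \<le> r" and xs: "wnorm r xs n \<le> 1" and i: "i < n"
  shows "norm (xs i) \<le> 1"
proof -
  have le: "xs i x \<le> 1" if "norm x \<le> 1" for x
  proof -
    have "lpn r (\<lambda>i. eval_at x (xs i)) n \<le> 1"
      using xs that norm_eval_at_le[of x] unfolding wnorm_le_iff[OF r] by (meson order_trans)
    then show ?thesis using abs_le_lpn[OF r i, of "\<lambda>i. xs i x"] by simp
  qed
  have "xs i x \<le> norm x" for x
    using le[of "inverse (norm x) *\<^sub>R x"]
    by (cases "x = 0") (simp_all add: blinfun.scaleR_right blinfun.zero_right field_simps)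
  then show ?thesis by (simp add: norm_le_1_iff)
qed

text \<open>A functional on the bidual restricts along \<open>eval_at\<close> to a functional on the
  space of no larger norm.\<close>

lemma wnorm_eval_at:
  fixes x :: "nat \<Rightarrow> 'a::real_normed_vector"
  assumes r: "1 \<le> r"
  shows "wnorm r (\<lambda>i. eval_at (x i)) n \<le> wnorm r x n"
  unfolding wnorm_le_iff[OF r]
proof (intro allI impI)
  fix \<Psi> :: "(('a \<Rightarrow>\<^sub>L real) \<Rightarrow>\<^sub>L real) \<Rightarrow>\<^sub>L real" assume \<Psi>: "norm \<Psi> \<le> 1"
  have "linear (\<lambda>x. \<Psi> (eval_at x))"
  proof (rule linearI)
    show "\<Psi> (eval_at (x + y)) = \<Psi> (eval_at x) + \<Psi> (eval_at y)" for x y :: 'a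
      by (simp add: eval_at_add blinfun.add_right)
    show "\<Psi> (eval_at (c *\<^sub>R x)) = c *\<^sub>R \<Psi> (eval_at x)" for c and x :: 'a
      by (simp add: eval_at_scaleR blinfun.scaleR_right)
  qed
  moreover have "\<Psi> (eval_at x) \<le> 1 * norm x" for x
    using \<Psi> norm_eval_at_le[of x] norm_le_1_iff[of \<Psi>] by (metis mult_1 order_trans)
  ultimately obtain \<phi> :: "'a \<Rightarrow>\<^sub>L real" where \<phi>: "\<And>x. \<phi> x = \<Psi> (eval_at x)" "norm \<phi> \<le> 1"
    using Blinfun_exists zero_le_one by metis
  then show "lpn r (\<lambda>i. \<Psi> (eval_at (x i))) n \<le> wnorm r x n"
    using wnorm_le_iff[OF r, of x n "wnorm r x n"] by (simp flip: \<phi>(1))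
qed

text \<open>The absolute value disappears because the test families are closed under a change of
  sign.\<close>

lemma cohen_norm_le_iff:
  fixes x :: "nat \<Rightarrow> 'a::real_normed_vector"
  assumes r: "1 \<le> r"
  shows "cohen_norm r x n \<le> c \<longleftrightarrow>
    (\<forall>xs :: nat \<Rightarrow> 'a \<Rightarrow>\<^sub>L real. wnorm (conj_exp r) xs n \<le> 1 \<longrightarrow> (\<Sum>i<n. blinfun_apply (xs i) (x i)) \<le> c)"
proof -
  have r': "1 \<le> conj_exp r" using r by (rule one_le_conj_exp)
  let ?S = "(\<lambda>xs. \<bar>\<Sum>i<n. blinfun_apply (xs i) (x i)\<bar>) `
    {xs :: nat \<Rightarrow> 'a \<Rightarrow>\<^sub>L real. wnorm (conj_exp r) xs n \<le> 1}"
  have "wnorm (conj_exp r) (\<lambda>i. 0 :: 'a \<Rightarrow>\<^sub>L real) n \<le> 0"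
    unfolding wnorm_le_iff[OF r'] using lpn_scale[OF r', of 0 "\<lambda>_. 0" n] by (simp add: blinfun.zero_right)
  then have "?S \<noteq> {}" by (auto intro!: exI[of _ "\<lambda>_. 0"] intro: order_trans)
  moreover have "\<bar>\<Sum>i<n. blinfun_apply (xs i) (x i)\<bar> \<le> (\<Sum>i<n. norm (x i))" if "wnorm (conj_exp r) xs n \<le> 1" for xs :: "nat \<Rightarrow> 'a \<Rightarrow>\<^sub>L real"
  proof -
    have "\<bar>blinfun_apply (xs i) (x i)\<bar> \<le> norm (x i)" if "i < n" for i
      using norm_le_1_of_wnorm_le_1[OF r' \<open>wnorm _ xs n \<le> 1\<close> that] norm_le_1_iff[of "xs i"]
      by (metis abs_le_iff blinfun.minus_right norm_minus_cancel)
    then show ?thesis by (intro order_trans[OF sum_abs] sum_mono) auto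
  qed
  ultimately have "cohen_norm r x n \<le> c \<longleftrightarrow> (\<forall>y\<in>?S. y \<le> c)"
    unfolding cohen_norm_def by (intro cSup_le_iff) (auto simp: bdd_above_def)
  also have "\<dots> \<longleftrightarrow> (\<forall>xs :: nat \<Rightarrow> 'a \<Rightarrow>\<^sub>L real. wnorm (conj_exp r) xs n \<le> 1 \<longrightarrow> (\<Sum>i<n. blinfun_apply (xs i) (x i)) \<le> c)"
    (is "_ \<longleftrightarrow> ?R")
  proof
    assume R: ?R
    have "- (\<Sum>i<n. blinfun_apply (xs i) (x i)) \<le> c" if "wnorm (conj_exp r) xs n \<le> 1" for xs :: "nat \<Rightarrow> 'a \<Rightarrow>\<^sub>L real"
      using R[rule_format, of "\<lambda>i. - xs i"] that wnorm_uminus[OF r', of xs n]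
      by (simp add: blinfun.minus_left sum_negf)
    with R show "\<forall>y\<in>?S. y \<le> c" by (auto simp: abs_le_iff)
  qed (auto simp: abs_le_iff)
  finally show ?thesis .
qed

text \<open>The order of a dual is given by \<open>dpos\<close> and \<open>dabs\<close> and not by a
  type class. The axioms collect what the scaling arguments share between a lattice and its
  dual.\<close>

locale positive_cone =
  fixes pos :: "'z::real_normed_vector \<Rightarrow> bool" and absv :: "'z \<Rightarrow> 'z"
  assumes pos_0: "pos 0" and pos_absv: "pos (absv z)"
    and pos_scaleR: "0 < c \<Longrightarrow> pos w \<Longrightarrow> pos (c *\<^sub>R w)"
    and absv_scaleR: "0 < c \<Longrightarrow> absv (c *\<^sub>R w) = c *\<^sub>R absv w"
begin

text \<open>Positive families in the unit ball of the strong-to-weak norm that defines the \<open>\<ell>\<^sub>r\<^sup>\<pi>\<close> norms.\<close>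

definition dual_ball :: "ereal \<Rightarrow> (nat \<Rightarrow> 'z \<Rightarrow>\<^sub>L real) \<Rightarrow> nat \<Rightarrow> bool" where
  "dual_ball r y n \<longleftrightarrow> (\<forall>i. posfun pos (y i)) \<and>
    (\<forall>w. norm w \<le> 1 \<longrightarrow> pos w \<longrightarrow> lpn r (\<lambda>i. y i w) n \<le> 1)"

lemma dual_ball_le_norm:
  assumes r: "1 \<le> r" and y: "dual_ball r y n" and w: "pos w"
  shows "lpn r (\<lambda>i. y i w) n \<le> norm w"
proof (cases "w = 0")
  case True
  then show ?thesis using lpn_scale[OF r, of 0 "\<lambda>_. 0" n] by (simp add: blinfun.zero_right)
next
  case False
  then have "lpn r (\<lambda>i. y i (inverse (norm w) *\<^sub>R w)) n \<le> 1"
    using y pos_scaleR[OF _ w, of "inverse (norm w)"] by (simp add: dual_ball_def)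
  then have "inverse (norm w) * lpn r (\<lambda>i. y i w) n \<le> 1"
    using lpn_scale[OF r, of "inverse (norm w)" "\<lambda>i. y i w" n] by (simp add: blinfun.scaleR_right)
  then show ?thesis using False by (simp add: field_simps)
qed

text \<open>At \<open>r = 1\<close> the pi-norm is the sum of the norms by convention, which
  \<open>pinorm_lattice_le_iff\<close> treats separately.\<close>

lemma pinorm_le_iff:
  assumes r: "1 \<le> r" "r \<noteq> 1"
  shows "pinorm pos absv r z n \<le> c \<longleftrightarrow>
    (\<forall>y. dual_ball (conj_exp r) y n \<longrightarrow> (\<Sum>i<n. blinfun_apply (y i) (absv (z i))) \<le> c)"
proof -
  have r': "1 \<le> conj_exp r" using r(1) by (rule one_le_conj_exp)
  have Sup_iff: "Sup ((\<lambda>w. lpn (conj_exp r) (\<lambda>i. blinfun_apply (y i) w) n) ` {w. norm w \<le> 1 \<and> pos w}) \<le> 1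
      \<longleftrightarrow> (\<forall>w. norm w \<le> 1 \<longrightarrow> pos w \<longrightarrow> lpn (conj_exp r) (\<lambda>i. y i w) n \<le> 1)" for y :: "nat \<Rightarrow> 'z \<Rightarrow>\<^sub>L real"
  proof -
    have "lpn (conj_exp r) (\<lambda>i. y i w) n \<le> (\<Sum>i<n. norm (y i))" if "norm w \<le> 1" for w
      using lpn_apply_le_sum_norm[OF r', of "eval_at w" y n] norm_eval_at_le[of w] that by simp
    then have "bdd_above ((\<lambda>w. lpn (conj_exp r) (\<lambda>i. blinfun_apply (y i) w) n) ` {w. norm w \<le> 1 \<and> pos w})"
      by (intro bdd_aboveI2) auto
    moreover have "{w. norm w \<le> 1 \<and> pos w} \<noteq> {}" using pos_0 by (auto intro: exI[of _ 0])
    ultimately show ?thesis by (subst cSup_le_iff) auto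
  qed
  let ?S = "(\<lambda>y. \<Sum>i<n. blinfun_apply (y i) (absv (z i))) ` {y. dual_ball (conj_exp r) y n}"
  have "pinorm pos absv r z n = Sup ?S"
    unfolding pinorm_def Sup_iff dual_ball_def using r(2) by simp
  moreover have "dual_ball (conj_exp r) (\<lambda>_. 0) n"
    using lpn_scale[OF r', of 0 "\<lambda>_. 0" n] by (simp add: dual_ball_def posfun_def)
  moreover have "(\<Sum>i<n. blinfun_apply (y i) (absv (z i))) \<le> (\<Sum>i<n. norm (absv (z i)))" if "dual_ball (conj_exp r) y n" for y
    using dual_ball_le_norm[OF r' that pos_absv] abs_le_lpn[OF r', of _ n]
    by (intro sum_mono) (meson abs_ge_self lessThan_iff order_trans)
  ultimately show ?thesis
    by (simp, subst cSup_le_iff) (auto simp: bdd_above_def)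
qed

lemma absweak_scaleR_le:
  assumes r: "1 \<le> r" and t: "0 < t"
  shows "absweak pos absv r (\<lambda>i. t *\<^sub>R z i) n \<le> t * absweak pos absv r z n"
  unfolding absweak_le_iff[OF r]
  using t absweak_le_iff[OF r, of pos absv z n "absweak pos absv r z n"]
  by (simp add: blinfun.scaleR_right lpn_scale[OF r] absv_scaleR)

lemma pinorm_scaleR_ge:
  assumes r: "1 \<le> r" and t: "0 < t"
  shows "t * pinorm pos absv r z n \<le> pinorm pos absv r (\<lambda>i. t *\<^sub>R z i) n"
proof (cases "r = 1")
  case True
  then show ?thesis using t by (simp add: pinorm_def sum_distrib_left)
next
  case False
  have "pinorm pos absv r z n \<le> pinorm pos absv r (\<lambda>i. t *\<^sub>R z i) n / t"
    unfolding pinorm_le_iff[OF r False]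
  proof (intro allI impI)
    fix y assume "dual_ball (conj_exp r) y n"
    then have "(\<Sum>i<n. blinfun_apply (y i) (absv (t *\<^sub>R z i))) \<le> pinorm pos absv r (\<lambda>i. t *\<^sub>R z i) n"
      using pinorm_le_iff[OF r False, of "\<lambda>i. t *\<^sub>R z i" n "pinorm pos absv r (\<lambda>i. t *\<^sub>R z i) n"] by simp
    moreover have "(\<Sum>i<n. blinfun_apply (y i) (absv (t *\<^sub>R z i))) = t * (\<Sum>i<n. blinfun_apply (y i) (absv (z i)))"
      using t by (simp add: absv_scaleR blinfun.scaleR_right sum_distrib_left)
    ultimately show "(\<Sum>i<n. blinfun_apply (y i) (absv (z i))) \<le> pinorm pos absv r (\<lambda>i. t *\<^sub>R z i) n / t"
      using t by (simp add: field_simps)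
  qed
  then show ?thesis using t by (simp add: field_simps)
qed

end

lemma cohen_norm_scaleR_ge:
  fixes x :: "nat \<Rightarrow> 'a::real_normed_vector"
  assumes r: "1 \<le> r" and t: "0 < t"
  shows "t * cohen_norm r x n \<le> cohen_norm r (\<lambda>i. t *\<^sub>R x i) n"
proof -
  have "cohen_norm r x n \<le> cohen_norm r (\<lambda>i. t *\<^sub>R x i) n / t"
    unfolding cohen_norm_le_iff[OF r]
  proof (intro allI impI)
    fix xs :: "nat \<Rightarrow> 'a \<Rightarrow>\<^sub>L real" assume "wnorm (conj_exp r) xs n \<le> 1"
    then have "(\<Sum>i<n. blinfun_apply (xs i) (t *\<^sub>R x i)) \<le> cohen_norm r (\<lambda>i. t *\<^sub>R x i) n"
      using cohen_norm_le_iff[OF r, of "\<lambda>i. t *\<^sub>R x i" n "cohen_norm r (\<lambda>i. t *\<^sub>R x i) n"] by simp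
    moreover have "(\<Sum>i<n. blinfun_apply (xs i) (t *\<^sub>R x i)) = t * (\<Sum>i<n. blinfun_apply (xs i) (x i))"
      by (simp add: blinfun.scaleR_right sum_distrib_left)
    ultimately show "(\<Sum>i<n. blinfun_apply (xs i) (x i)) \<le> cohen_norm r (\<lambda>i. t *\<^sub>R x i) n / t"
      using t by (simp add: field_simps)
  qed
  then show ?thesis using t by (simp add: field_simps)
qed

text \<open>As \<open>N x\<close> may vanish, \<open>x\<close> is divided by an arbitrary
  \<open>s > N x\<close>.\<close>

lemma le_mult_iff_on_unit_ball:
  fixes A N :: "(nat \<Rightarrow> 'v::real_vector) \<Rightarrow> real"
  assumes C: "0 \<le> C" and N0: "\<And>x. 0 \<le> N x"
    and N: "\<And>t x. 0 < t \<Longrightarrow> N (\<lambda>i. t *\<^sub>R x i) \<le> t * N x"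
    and A: "\<And>t x. 0 < t \<Longrightarrow> t * A x \<le> A (\<lambda>i. t *\<^sub>R x i)"
  shows "(\<forall>x. A x \<le> C * N x) \<longleftrightarrow> (\<forall>x. N x \<le> 1 \<longrightarrow> A x \<le> C)"
proof safe
  fix x assume "\<forall>x. A x \<le> C * N x" "N x \<le> 1"
  then show "A x \<le> C" using C by (meson mult_left_le order_trans)
next
  fix x assume *: "\<forall>x. N x \<le> 1 \<longrightarrow> A x \<le> C"
  show "A x \<le> C * N x"
  proof (rule le_mult_of_greater[OF C])
    fix s assume s: "N x < s"
    then have s0: "0 < s" using N0[of x] by simp
    have "N (\<lambda>i. inverse s *\<^sub>R x i) \<le> inverse s * N x" using s0 by (intro N) simp
    also have "\<dots> \<le> 1" using s s0 by (simp add: field_simps)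
    finally have "A (\<lambda>i. inverse s *\<^sub>R x i) \<le> C" using * by blast
    then have "inverse s * A x \<le> C" using A[of "inverse s" x] s0 by simp
    then show "A x \<le> C * s" using s0 by (simp add: field_simps)
  qed
qed

section \<open>Duality\<close>

lemma apply_le_dabs: "blinfun_apply f x \<le> dabs f (labs x)"
  using abs_apply_le_dabs[of f x] by simp

lemma dabs_scaleR:
  assumes "0 < c"
  shows "dabs (c *\<^sub>R f) = c *\<^sub>R dabs f"
proof -
  have le: "dabs (c *\<^sub>R f) x \<le> c * dabs f x" if "0 < c" "0 \<le> x" for c f x
  proof (rule dabs_apply_le[OF that(2)])
    fix y assume "labs y \<le> x"
    then have "blinfun_apply f y \<le> dabs f x"
      using apply_le_dabs[of f y] dpos_mono[OF dpos_dabs, of "labs y" x f] by simp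
    then show "(c *\<^sub>R f) y \<le> c * dabs f x" using that by (simp add: blinfun.scaleR_left)
  qed
  have eq: "dabs (c *\<^sub>R f) x = c * dabs f x" if "0 \<le> x" for x
    using le[OF assms that, of f] le[of "inverse c" x "c *\<^sub>R f"] that assms by (simp add: field_simps)
  show ?thesis
  proof (rule blinfun_eqI)
    fix x
    have "dabs (c *\<^sub>R f) (pprt x - pprt (- x)) = (c *\<^sub>R dabs f) (pprt x - pprt (- x))"
      by (simp add: blinfun.diff_right eq blinfun.scaleR_left algebra_simps)
    then show "dabs (c *\<^sub>R f) x = (c *\<^sub>R dabs f) x" by (simp flip: pprt_diff_pprt)
  qed
qed

interpretation lattice_cone: positive_cone lpos labs
  by standard (simp_all add: scaleR_nonneg_nonneg labs_scaleR)

interpretation dual_cone: positive_cone dpos dabs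
  by standard (simp_all add: dpos_dabs dabs_scaleR, simp_all add: dpos_def blinfun.scaleR_left)

lemma posfun_lpos_iff: "posfun lpos f \<longleftrightarrow> dpos f"
  by (simp add: posfun_def dpos_def)

lemma posfun_dpos_eval_at: "0 \<le> x \<Longrightarrow> posfun dpos (eval_at x)"
  by (simp add: posfun_def dpos_def)

lemma le_norm_pprt_iff:
  fixes \<phi> :: "'a::banach_lattice \<Rightarrow>\<^sub>L real"
  shows "(\<forall>x. \<phi> x \<le> norm (pprt x)) \<longleftrightarrow> dpos \<phi> \<and> norm \<phi> \<le> 1"
proof safe
  assume le: "\<forall>x. \<phi> x \<le> norm (pprt x)"
  have "0 \<le> \<phi> x" if "0 \<le> x" for x
  proof -
    have "pprt (- x) = 0" using that by (simp add: pprt_def sup_absorb2)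
    then show ?thesis using le[rule_format, of "- x"] by (simp add: blinfun.minus_right)
  qed
  then show "dpos \<phi>" by (simp add: dpos_def)
  show "norm \<phi> \<le> 1" using le norm_pprt_le order_trans unfolding norm_le_1_iff by blast
next
  fix x assume "dpos \<phi>" "norm \<phi> \<le> 1"
  then show "\<phi> x \<le> norm (pprt x)"
    using dpos_mono[OF _ le_pprt, of \<phi> x] norm_le_1_iff order_trans by blast
qed

text \<open>At \<open>r = 1\<close> the conjugate exponent is infinite, so the ball restricts each
  \<open>y i\<close> separately; norming functionals for the individual \<open>z i\<close> then
  attain the sum of the norms.\<close>

lemma pinorm_lattice_le_iff:
  fixes z :: "nat \<Rightarrow> 'a::banach_lattice"
  assumes r: "1 \<le> r"
  shows "pinorm lpos labs r z n \<le> c \<longleftrightarrow>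
    (\<forall>y. lattice_cone.dual_ball (conj_exp r) y n \<longrightarrow> (\<Sum>i<n. blinfun_apply (y i) (labs (z i))) \<le> c)"
proof (cases "r = 1")
  case False
  then show ?thesis by (rule lattice_cone.pinorm_le_iff[OF r])
next
  case True
  have eq: "pinorm lpos labs r z n = (\<Sum>i<n. norm (z i))" using True by (simp add: pinorm_def)
  show ?thesis
  proof safe
    fix y :: "nat \<Rightarrow> 'a \<Rightarrow>\<^sub>L real"
    assume c: "pinorm lpos labs r z n \<le> c" and y: "lattice_cone.dual_ball (conj_exp r) y n"
    have "blinfun_apply (y i) (labs (z i)) \<le> norm (z i)" if "i < n" for i
      using lattice_cone.dual_ball_le_norm[OF one_le_conj_exp[OF r] y, of "labs (z i)"]
        abs_le_lpn[OF one_le_conj_exp[OF r] that, of "\<lambda>j. y j (labs (z i))"] by simp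
    then have "(\<Sum>i<n. y i (labs (z i))) \<le> (\<Sum>i<n. norm (z i))" by (intro sum_mono) simp
    then show "(\<Sum>i<n. y i (labs (z i))) \<le> c" using c eq by simp
  next
    assume *: "\<forall>y. lattice_cone.dual_ball (conj_exp r) y n \<longrightarrow> (\<Sum>i<n. blinfun_apply (y i) (labs (z i))) \<le> c"
    have "\<exists>u. dpos u \<and> norm u \<le> 1 \<and> blinfun_apply u (labs (z i)) = norm (z i)" for i
      using norming_functional[of "z i"] by blast
    then obtain u where u: "\<And>i. dpos (u i)" "\<And>i. norm (u i) \<le> 1" "\<And>i. blinfun_apply (u i) (labs (z i)) = norm (z i)"
      by metis
    have "lattice_cone.dual_ball (conj_exp r) u n"
      unfolding lattice_cone.dual_ball_def posfun_lpos_iff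
    proof (intro conjI allI impI u(1))
      fix w :: 'a assume "norm w \<le> 1" "0 \<le> w"
      moreover have "u i w \<le> norm w" for i using u(2) norm_le_1_iff by blast
      moreover have "0 \<le> u i w" for i using u(1) \<open>0 \<le> w\<close> by (simp add: dpos_def)
      ultimately show "lpn (conj_exp r) (\<lambda>i. u i w) n \<le> 1"
        using True by (auto simp: lpn_PInf_le_iff intro: order_trans)
    qed
    with * have "(\<Sum>i<n. u i (labs (z i))) \<le> c" by blast
    then show "pinorm lpos labs r z n \<le> c" using eq u(3) by simp
  qed
qed

text \<open>Passing from \<open>u\<close> to \<open>dabs u\<close> gives one direction, from
  \<open>y\<close> to functionals of modulus at most \<open>y\<close> that attain the pairing the
  other. The difficulty of the latter is that \<open>absweak\<close> tests with the bidual, while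
  \<open>dual_ball\<close> tests only with the lattice.\<close>

lemma pairing_lattice_iff:
  fixes v :: "nat \<Rightarrow> 'a::banach_lattice"
  assumes r: "1 \<le> r"
  shows "(\<forall>y. lattice_cone.dual_ball r y n \<longrightarrow> (\<Sum>i<n. blinfun_apply (y i) (labs (v i))) \<le> C) \<longleftrightarrow>
    (\<forall>u. absweak dpos dabs r u n \<le> 1 \<longrightarrow> (\<Sum>i<n. blinfun_apply (u i) (v i)) \<le> C)"
proof safe
  fix u :: "nat \<Rightarrow> 'a \<Rightarrow>\<^sub>L real"
  assume *: "\<forall>y. lattice_cone.dual_ball r y n \<longrightarrow> (\<Sum>i<n. blinfun_apply (y i) (labs (v i))) \<le> C"
    and u: "absweak dpos dabs r u n \<le> 1"
  have "lattice_cone.dual_ball r (\<lambda>i. dabs (u i)) n"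
    unfolding lattice_cone.dual_ball_def posfun_lpos_iff
  proof (intro conjI allI impI dpos_dabs)
    fix w :: 'a assume "norm w \<le> 1" "0 \<le> w"
    then have "lpn r (\<lambda>i. eval_at w (dabs (u i))) n \<le> 1"
      using u norm_eval_at_le[of w] posfun_dpos_eval_at[of w] unfolding absweak_le_iff[OF r]
      by (meson order_trans)
    then show "lpn r (\<lambda>i. dabs (u i) w) n \<le> 1" by simp
  qed
  with * have "(\<Sum>i<n. dabs (u i) (labs (v i))) \<le> C" by blast
  moreover have "(\<Sum>i<n. u i (v i)) \<le> (\<Sum>i<n. dabs (u i) (labs (v i)))"
    by (intro sum_mono apply_le_dabs)
  ultimately show "(\<Sum>i<n. u i (v i)) \<le> C" by simp
next
  fix y :: "nat \<Rightarrow> 'a \<Rightarrow>\<^sub>L real"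
  assume *: "\<forall>u. absweak dpos dabs r u n \<le> 1 \<longrightarrow> (\<Sum>i<n. blinfun_apply (u i) (v i)) \<le> C"
    and y: "lattice_cone.dual_ball r y n"
  then have y_pos: "dpos (y i)" for i by (simp add: lattice_cone.dual_ball_def posfun_lpos_iff)
  have "\<exists>u. (\<forall>x. \<bar>blinfun_apply u x\<bar> \<le> y i (labs x)) \<and> u (v i) = y i (labs (v i))" for i
    using modulus_attained[OF y_pos[of i], of "v i"] by metis
  then obtain u :: "nat \<Rightarrow> 'a \<Rightarrow>\<^sub>L real" where
    u: "\<And>i x. \<bar>u i x\<bar> \<le> y i (labs x)" "\<And>i. u i (v i) = y i (labs (v i))" by metis
  have u_le: "dpos (y i - dabs (u i))" for i
  proof -
    have "dabs (u i) x \<le> y i x" if "0 \<le> x" for x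
      using that u(1)[of i] dpos_mono[OF y_pos[of i]] by (intro dabs_apply_le) (auto simp: abs_le_iff intro: order_trans)
    then show ?thesis by (simp add: dpos_def blinfun.diff_left)
  qed
  have "absweak dpos dabs r u n \<le> 1"
    unfolding absweak_le_iff[OF r]
  proof (intro allI impI)
    fix \<Phi> :: "('a \<Rightarrow>\<^sub>L real) \<Rightarrow>\<^sub>L real" assume \<Phi>: "norm \<Phi> \<le> 1" "posfun dpos \<Phi>"
    obtain a where a: "lpn (conj_exp r) a n \<le> 1"
      "(\<Sum>i<n. a i * \<Phi> (dabs (u i))) = lpn r (\<lambda>i. \<Phi> (dabs (u i))) n" "\<And>i. 0 \<le> \<Phi> (dabs (u i)) \<Longrightarrow> 0 \<le> a i"
      using lpn_attained[OF r, of n "\<lambda>i. \<Phi> (dabs (u i))"] by metis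
    have a_pos: "0 \<le> a i" for i using a(3) \<Phi>(2) dpos_dabs by (auto simp: posfun_def)
    \<comment> \<open>The coefficients \<open>a\<close> turn the norm of the sequence of values of
      \<open>\<Phi>\<close> into one value, bounded by \<open>\<Phi> F\<close>. The norm of
      \<open>F\<close> is computed on the lattice alone, where \<open>dual_ball\<close>
      applies.\<close>
    define F where "F = (\<Sum>i<n. a i *\<^sub>R y i)"
    have F_app: "F x = (\<Sum>i<n. a i * y i x)" for x
      by (simp add: F_def blinfun.sum_left blinfun.scaleR_left)
    have "norm F \<le> 1"
      unfolding norm_le_1_iff
    proof
      fix x
      have "F x \<le> (\<Sum>i<n. a i * y i (labs x))"
        unfolding F_app using a_pos y_pos by (intro sum_mono mult_left_mono dpos_mono le_labs) auto
      also have "\<dots> \<le> lpn (conj_exp r) a n * lpn r (\<lambda>i. y i (labs x)) n"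
        using Holder_lpn[OF one_le_conj_exp[OF r]] conj_exp_conj_exp[OF r] by metis
      also have "\<dots> \<le> 1 * norm (labs x)"
        by (intro mult_mono a(1) lattice_cone.dual_ball_le_norm[OF r y] lpn_nonneg) auto
      finally show "F x \<le> norm x" by simp
    qed
    have "lpn r (\<lambda>i. \<Phi> (dabs (u i))) n = (\<Sum>i<n. a i * \<Phi> (dabs (u i)))" using a(2) by simp
    also have "\<dots> \<le> (\<Sum>i<n. a i * \<Phi> (y i))"
    proof (intro sum_mono mult_left_mono a_pos)
      show "\<Phi> (dabs (u i)) \<le> \<Phi> (y i)" for i
        using \<Phi>(2) u_le[of i] unfolding posfun_def by (metis blinfun.diff_right diff_ge_0_iff_ge)
    qed
    also have "\<dots> = \<Phi> F" by (simp add: F_def blinfun.sum_right blinfun.scaleR_right)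
    also have "\<dots> \<le> norm F" using \<Phi>(1) norm_le_1_iff by blast
    also note \<open>norm F \<le> 1\<close>
    finally show "lpn r (\<lambda>i. \<Phi> (dabs (u i))) n \<le> 1" .
  qed
  with * have "(\<Sum>i<n. u i (v i)) \<le> C" by blast
  then show "(\<Sum>i<n. y i (labs (v i))) \<le> C" using u(2) by simp
qed

text \<open>Near-maximisers in the Riesz-Kantorovich formula are chosen for each index
  independently, and the error \<open>n * e\<close> tends to 0.\<close>

lemma sum_dabs_le:
  fixes g :: "nat \<Rightarrow> 'a::banach_lattice \<Rightarrow>\<^sub>L real"
  assumes z: "\<And>i. 0 \<le> z i" and le: "\<And>v. (\<And>i. labs (v i) \<le> z i) \<Longrightarrow> (\<Sum>i<n. g i (v i)) \<le> C"
  shows "(\<Sum>i<n. dabs (g i) (z i)) \<le> C"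
proof -
  have approx: "(\<Sum>i<n. dabs (g i) (z i)) \<le> C + real n * e" if e: "0 < e" for e
  proof -
    have "\<exists>v. labs v \<le> z i \<and> dabs (g i) (z i) - e < g i v" for i
      using dabs_apply_le[OF z[of i], of "g i" "dabs (g i) (z i) - e"] e by force
    then obtain v where v: "\<And>i. labs (v i) \<le> z i" "\<And>i. dabs (g i) (z i) - e < g i (v i)" by metis
    have "(\<Sum>i<n. dabs (g i) (z i) - e) \<le> (\<Sum>i<n. g i (v i))"
      by (intro sum_mono less_imp_le v(2))
    also have "\<dots> \<le> C" using v(1) by (rule le)
    finally show ?thesis by (simp add: sum_subtractf)
  qed
  have "(\<Sum>i<n. dabs (g i) (z i)) - C \<le> real n * 0"
    by (rule le_mult_of_greater) (use approx in \<open>simp_all add: diff_le_eq add.commute\<close>)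
  then show ?thesis by simp
qed

lemma dominated_functionals_pprt:
  "dominated_functionals (\<lambda>x :: 'a::banach_lattice. norm (pprt x)) {x. 0 \<le> x}"
  by standard (auto simp: sublinear_norm_pprt norm_pprt_le scaleR_nonneg_nonneg)

lemma dominated_functionals_norm:
  "dominated_functionals (norm :: 'a::real_normed_vector \<Rightarrow> real) UNIV"
  by standard (auto simp: sublinear_def norm_triangle_ineq)

text \<open>Evaluations at \<open>labs (z i)\<close> are special families \<open>G\<close>.
  Conversely, local reflexivity for the positive cone reduces \<open>G\<close> to positive
  \<open>z\<close>, and \<open>sum_dabs_le\<close> then trades \<open>dabs (g i)\<close> for
  \<open>g i\<close> on elements of modulus at most \<open>z i\<close>.\<close>

lemma pairing_dual_lattice_iff:
  fixes g :: "nat \<Rightarrow> 'a::banach_lattice \<Rightarrow>\<^sub>L real"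
  assumes r: "1 \<le> r" and C: "0 \<le> C"
  shows "(\<forall>G. dual_cone.dual_ball r G n \<longrightarrow> (\<Sum>i<n. blinfun_apply (G i) (dabs (g i))) \<le> C) \<longleftrightarrow>
    (\<forall>z. absweak lpos labs r z n \<le> 1 \<longrightarrow> (\<Sum>i<n. g i (z i)) \<le> C)"
proof safe
  fix z :: "nat \<Rightarrow> 'a"
  assume *: "\<forall>G. dual_cone.dual_ball r G n \<longrightarrow> (\<Sum>i<n. blinfun_apply (G i) (dabs (g i))) \<le> C"
    and z: "absweak lpos labs r z n \<le> 1"
  have "dual_cone.dual_ball r (\<lambda>i. eval_at (labs (z i))) n"
    using z unfolding dual_cone.dual_ball_def absweak_le_iff[OF r] posfun_lpos_iff
    by (simp add: posfun_dpos_eval_at)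
  with * have "(\<Sum>i<n. eval_at (labs (z i)) (dabs (g i))) \<le> C" by blast
  moreover have "(\<Sum>i<n. g i (z i)) \<le> (\<Sum>i<n. dabs (g i) (labs (z i)))"
    by (intro sum_mono apply_le_dabs)
  ultimately show "(\<Sum>i<n. g i (z i)) \<le> C" by simp
next
  fix G :: "nat \<Rightarrow> ('a \<Rightarrow>\<^sub>L real) \<Rightarrow>\<^sub>L real"
  assume *: "\<forall>z. absweak lpos labs r z n \<le> 1 \<longrightarrow> (\<Sum>i<n. g i (z i)) \<le> C"
    and G: "dual_cone.dual_ball r G n"
  show "(\<Sum>i<n. G i (dabs (g i))) \<le> C"
  proof (rule dominated_functionals.bidual_weakly_summable[OF dominated_functionals_pprt r C])
    fix z :: "nat \<Rightarrow> 'a"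
    assume z: "\<And>i. z i \<in> {x. 0 \<le> x}"
      and le: "\<And>\<phi> :: 'a \<Rightarrow>\<^sub>L real. (\<And>x. \<phi> x \<le> norm (pprt x)) \<Longrightarrow> lpn r (\<lambda>i. \<phi> (z i)) n \<le> 1"
    show "(\<Sum>i<n. dabs (g i) (z i)) \<le> C"
    proof (rule sum_dabs_le)
      fix v assume v: "\<And>i. labs (v i) \<le> z i"
      have "absweak lpos labs r v n \<le> 1"
        unfolding absweak_le_iff[OF r] posfun_lpos_iff
      proof (intro allI impI)
        fix \<phi> :: "'a \<Rightarrow>\<^sub>L real" assume \<phi>: "norm \<phi> \<le> 1" "dpos \<phi>"
        have "0 \<le> \<phi> (labs (v i))" for i using \<phi>(2) by (simp add: dpos_def)
        moreover have "\<phi> (labs (v i)) \<le> \<phi> (z i)" for i using dpos_mono[OF \<phi>(2) v] .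
        ultimately have "lpn r (\<lambda>i. \<phi> (labs (v i))) n \<le> lpn r (\<lambda>i. \<phi> (z i)) n"
          by (intro lpn_mono[OF r]) (simp add: abs_of_nonneg order_trans[OF _ abs_ge_self])
        also have "\<dots> \<le> 1" using le \<phi> le_norm_pprt_iff by blast
        finally show "lpn r (\<lambda>i. \<phi> (labs (v i))) n \<le> 1" .
      qed
      with * show "(\<Sum>i<n. g i (v i)) \<le> C" by blast
    qed (use z in simp)
  next
    fix i and h :: "'a \<Rightarrow>\<^sub>L real" assume "\<And>z. z \<in> {x. 0 \<le> x} \<Longrightarrow> 0 \<le> h z"
    then have "dpos h" by (simp add: dpos_def)
    then show "0 \<le> G i h" using G by (simp add: dual_cone.dual_ball_def posfun_def)
  next
    fix \<phi> :: "'a \<Rightarrow>\<^sub>L real" assume "\<And>x. \<phi> x \<le> norm (pprt x)"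
    then have "dpos \<phi>" "norm \<phi> \<le> 1" using le_norm_pprt_iff by blast+
    then show "lpn r (\<lambda>i. G i \<phi>) n \<le> 1" using G by (simp add: dual_cone.dual_ball_def)
  qed
qed

lemma pairing_bidual_iff:
  fixes g :: "nat \<Rightarrow> 'a::real_normed_vector \<Rightarrow>\<^sub>L real"
  assumes r: "1 \<le> r" and C: "0 \<le> C"
  shows "(\<forall>G. wnorm r G n \<le> 1 \<longrightarrow> (\<Sum>i<n. blinfun_apply (G i) (g i)) \<le> C) \<longleftrightarrow>
    (\<forall>x. wnorm r x n \<le> 1 \<longrightarrow> (\<Sum>i<n. g i (x i)) \<le> C)"
proof safe
  fix x :: "nat \<Rightarrow> 'a"
  assume *: "\<forall>G. wnorm r G n \<le> 1 \<longrightarrow> (\<Sum>i<n. blinfun_apply (G i) (g i)) \<le> C" and x: "wnorm r x n \<le> 1"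
  have "wnorm r (\<lambda>i. eval_at (x i)) n \<le> 1" using wnorm_eval_at[OF r, of x n] x by simp
  with * have "(\<Sum>i<n. eval_at (x i) (g i)) \<le> C" by blast
  then show "(\<Sum>i<n. g i (x i)) \<le> C" by simp
next
  fix G :: "nat \<Rightarrow> ('a \<Rightarrow>\<^sub>L real) \<Rightarrow>\<^sub>L real"
  assume *: "\<forall>x. wnorm r x n \<le> 1 \<longrightarrow> (\<Sum>i<n. g i (x i)) \<le> C" and G: "wnorm r G n \<le> 1"
  show "(\<Sum>i<n. G i (g i)) \<le> C"
  proof (rule dominated_functionals.bidual_weakly_summable[OF dominated_functionals_norm r C])
    fix x :: "nat \<Rightarrow> 'a"
    assume "\<And>\<phi> :: 'a \<Rightarrow>\<^sub>L real. (\<And>x. \<phi> x \<le> norm x) \<Longrightarrow> lpn r (\<lambda>i. \<phi> (x i)) n \<le> 1"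
    then have "wnorm r x n \<le> 1" by (simp add: wnorm_le_iff[OF r] norm_le_1_iff)
    with * show "(\<Sum>i<n. g i (x i)) \<le> C" by blast
  next
    \<comment> \<open>With the whole space as cone, a nonnegative functional is zero, so the
      positivity condition on \<open>G\<close> holds for every \<open>G\<close>.\<close>
    fix i and h :: "'a \<Rightarrow>\<^sub>L real" assume h: "\<And>z. z \<in> UNIV \<Longrightarrow> 0 \<le> h z"
    have "h z = 0" for z using h[of z] h[of "- z"] by (simp add: blinfun.minus_right)
    then have "h = 0" by (intro blinfun_eqI) simp
    then show "0 \<le> G i h" by (simp add: blinfun.zero_right)
  next
    fix \<phi> :: "'a \<Rightarrow>\<^sub>L real" assume "\<And>x. \<phi> x \<le> norm x"
    then have "norm (eval_at \<phi>) \<le> 1"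
      using norm_eval_at_le[of \<phi>] norm_le_1_iff[of \<phi>] by (meson order_trans)
    then have "lpn r (\<lambda>i. eval_at \<phi> (G i)) n \<le> 1" using G wnorm_le_iff[OF r] by blast
    then show "lpn r (\<lambda>i. G i \<phi>) n \<le> 1" by simp
  qed
qed

section \<open>Reduction of the inequalities to unit balls\<close>

context positive_cone
begin

lemma left_pcn_ineq_iff:
  fixes S :: "'z \<Rightarrow> 'h::real_normed_vector"
  assumes S: "\<And>c x. S (c *\<^sub>R x) = c *\<^sub>R S x" and p: "1 \<le> p" and q: "1 \<le> q" and C: "0 \<le> C"
  shows "left_pcn_ineq pos absv p q S C \<longleftrightarrow> (\<forall>n z. absweak pos absv q z n \<le> 1 \<longrightarrow>
    (\<forall>xs. wnorm (conj_exp p) xs n \<le> 1 \<longrightarrow> (\<Sum>i<n. blinfun_apply (xs i) (S (z i))) \<le> C))"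
  unfolding left_pcn_ineq_def cohen_norm_le_iff[OF p, symmetric]
  by (intro iff_allI le_mult_iff_on_unit_ball C absweak_nonneg absweak_scaleR_le q)
    (auto simp: S intro: cohen_norm_scaleR_ge[OF p])

lemma right_pcn_ineq_iff:
  fixes S :: "'g::real_normed_vector \<Rightarrow> 'z"
  assumes S: "\<And>c x. S (c *\<^sub>R x) = c *\<^sub>R S x" and p: "1 \<le> p" and q: "1 \<le> q" and C: "0 \<le> C"
  shows "right_pcn_ineq pos absv p q S C \<longleftrightarrow>
    (\<forall>n x. wnorm q x n \<le> 1 \<longrightarrow> pinorm pos absv p (\<lambda>i. S (x i)) n \<le> C)"
  unfolding right_pcn_ineq_def
  by (intro iff_allI le_mult_iff_on_unit_ball C wnorm_nonneg wnorm_scaleR_le q)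
    (auto simp: S intro: pinorm_scaleR_ge[OF p])

end

lemma pcn_ineq_iff:
  fixes S :: "'z::real_normed_vector \<Rightarrow> 'w::real_normed_vector"
  assumes S: "\<And>c x. S (c *\<^sub>R x) = c *\<^sub>R S x" and Z: "positive_cone posZ absZ" and W: "positive_cone posW absW"
    and p: "1 \<le> p" and q: "1 \<le> q" and C: "0 \<le> C"
  shows "pcn_ineq posZ absZ posW absW p q S C \<longleftrightarrow>
    (\<forall>n z. absweak posZ absZ q z n \<le> 1 \<longrightarrow> pinorm posW absW p (\<lambda>i. S (z i)) n \<le> C)"
  unfolding pcn_ineq_def
  by (intro iff_allI le_mult_iff_on_unit_ball C absweak_nonneg positive_cone.absweak_scaleR_le[OF Z] q)
    (auto simp: S intro: positive_cone.pinorm_scaleR_ge[OF W p])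

section \<open>Transfer of each inequality to the adjoint\<close>

lemma adj_apply: "blinfun_apply (adj T g) x = g (T x)"
  by (simp add: adj_def)

lemma adj_scaleR: "adj T (c *\<^sub>R g) = c *\<^sub>R adj T g"
  by (rule blinfun_eqI) (simp add: adj_apply blinfun.scaleR_left)

text \<open>Finite \<open>q\<close> keeps the pi-norm on the dual lattice away from the convention
  at exponent 1.\<close>

lemma conj_exp_neq_1: "1 \<le> q \<Longrightarrow> q \<noteq> \<infinity> \<Longrightarrow> conj_exp q \<noteq> 1"
  using conj_exp_conj_exp[of q] by auto

text \<open>Both sides bound \<open>(\<Sum>i<n. f i (T (z i)))\<close> by \<open>C\<close> over the
  same two unit balls, with the quantifiers over \<open>f\<close> and \<open>z\<close>
  exchanged.\<close>

lemma left_pcn_ineq_iff_adj: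
  fixes T :: "'x::banach_lattice \<Rightarrow>\<^sub>L 'f::real_normed_vector"
  assumes p: "1 \<le> p" and q: "1 \<le> q" "q \<noteq> \<infinity>" and C: "0 \<le> C"
  shows "left_pcn_ineq lpos labs p q T C \<longleftrightarrow>
    right_pcn_ineq dpos dabs (conj_exp q) (conj_exp p) (adj T) C"
proof -
  note p' = one_le_conj_exp[OF p] and q' = one_le_conj_exp[OF q(1)] conj_exp_neq_1[OF q]
  have "right_pcn_ineq dpos dabs (conj_exp q) (conj_exp p) (adj T) C \<longleftrightarrow>
    (\<forall>n f. wnorm (conj_exp p) f n \<le> 1 \<longrightarrow>
      (\<forall>z. absweak lpos labs q z n \<le> 1 \<longrightarrow> (\<Sum>i<n. adj T (f i) (z i)) \<le> C))"
    unfolding dual_cone.right_pcn_ineq_iff[of "adj T", OF adj_scaleR q'(1) p' C] dual_cone.pinorm_le_iff[OF q']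
      conj_exp_conj_exp[OF q(1)] pairing_dual_lattice_iff[OF q(1) C] ..
  then show ?thesis
    unfolding lattice_cone.left_pcn_ineq_iff[of "blinfun_apply T", OF blinfun.scaleR_right p q(1) C] adj_apply by blast
qed

text \<open>The bidual enters here through the Cohen norm on the dual of \<open>'e\<close>, and the
  pi-norm is that of the lattice \<open>'y\<close>, where \<open>p = 1\<close> may occur.\<close>

lemma right_pcn_ineq_iff_adj:
  fixes T :: "'e::real_normed_vector \<Rightarrow>\<^sub>L 'y::banach_lattice"
  assumes p: "1 \<le> p" and q: "1 \<le> q" and C: "0 \<le> C"
  shows "right_pcn_ineq lpos labs p q T C \<longleftrightarrow>
    left_pcn_ineq dpos dabs (conj_exp q) (conj_exp p) (adj T) C"
proof -
  note p' = one_le_conj_exp[OF p] and q' = one_le_conj_exp[OF q]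
  have "left_pcn_ineq dpos dabs (conj_exp q) (conj_exp p) (adj T) C \<longleftrightarrow>
    (\<forall>n u. absweak dpos dabs (conj_exp p) u n \<le> 1 \<longrightarrow>
      (\<forall>x. wnorm q x n \<le> 1 \<longrightarrow> (\<Sum>i<n. adj T (u i) (x i)) \<le> C))"
    unfolding dual_cone.left_pcn_ineq_iff[of "adj T", OF adj_scaleR q' p' C] conj_exp_conj_exp[OF q]
      pairing_bidual_iff[OF q C] ..
  moreover have "right_pcn_ineq lpos labs p q T C \<longleftrightarrow>
    (\<forall>n x. wnorm q x n \<le> 1 \<longrightarrow>
      (\<forall>u. absweak dpos dabs (conj_exp p) u n \<le> 1 \<longrightarrow> (\<Sum>i<n. blinfun_apply (u i) (T (x i))) \<le> C))"
    unfolding lattice_cone.right_pcn_ineq_iff[of "blinfun_apply T", OF blinfun.scaleR_right p q C]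
      pinorm_lattice_le_iff[OF p] pairing_lattice_iff[OF p'] ..
  ultimately show ?thesis unfolding adj_apply by blast
qed

lemma pcn_ineq_iff_adj:
  fixes T :: "'x::banach_lattice \<Rightarrow>\<^sub>L 'y::banach_lattice"
  assumes p: "1 \<le> p" and q: "1 \<le> q" "q \<noteq> \<infinity>" and C: "0 \<le> C"
  shows "pcn_ineq lpos labs lpos labs p q T C \<longleftrightarrow>
    pcn_ineq dpos dabs dpos dabs (conj_exp q) (conj_exp p) (adj T) C"
proof -
  note p' = one_le_conj_exp[OF p] and q' = one_le_conj_exp[OF q(1)] conj_exp_neq_1[OF q]
  have "pcn_ineq dpos dabs dpos dabs (conj_exp q) (conj_exp p) (adj T) C \<longleftrightarrow>
    (\<forall>n u. absweak dpos dabs (conj_exp p) u n \<le> 1 \<longrightarrow>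
      (\<forall>z. absweak lpos labs q z n \<le> 1 \<longrightarrow> (\<Sum>i<n. adj T (u i) (z i)) \<le> C))"
    unfolding pcn_ineq_iff[of "adj T", OF adj_scaleR dual_cone.positive_cone_axioms dual_cone.positive_cone_axioms q'(1) p' C]
      dual_cone.pinorm_le_iff[OF q'] conj_exp_conj_exp[OF q(1)] pairing_dual_lattice_iff[OF q(1) C] ..
  moreover have "pcn_ineq lpos labs lpos labs p q T C \<longleftrightarrow>
    (\<forall>n z. absweak lpos labs q z n \<le> 1 \<longrightarrow>
      (\<forall>u. absweak dpos dabs (conj_exp p) u n \<le> 1 \<longrightarrow> (\<Sum>i<n. blinfun_apply (u i) (T (z i))) \<le> C))"
    unfolding pcn_ineq_iff[of "blinfun_apply T", OF blinfun.scaleR_right lattice_cone.positive_cone_axioms lattice_cone.positive_cone_axioms p q(1) C]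
      pinorm_lattice_le_iff[OF p] pairing_lattice_iff[OF p'] ..
  ultimately show ?thesis unfolding adj_apply by blast
qed

text \<open>Membership in a class allows any real constant, its norm only nonnegative ones;
  \<open>max C 0\<close> connects the two.\<close>

lemma le_mult_max_0: "A \<le> C * N \<Longrightarrow> 0 \<le> N \<Longrightarrow> A \<le> max C 0 * N" for A C N :: real
  by (meson max.cobounded1 mult_right_mono order_trans)

lemma is_left_pcn_iff:
  "1 \<le> q \<Longrightarrow> is_left_pcn pos absv p q S \<longleftrightarrow> (\<exists>C\<ge>0. left_pcn_ineq pos absv p q S C)"
  unfolding is_left_pcn_def left_pcn_ineq_def
  by (meson le_mult_max_0 absweak_nonneg max.cobounded2)

lemma is_right_pcn_iff:
  "1 \<le> q \<Longrightarrow> is_right_pcn pos absv p q S \<longleftrightarrow> (\<exists>C\<ge>0. right_pcn_ineq pos absv p q S C)"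
  unfolding is_right_pcn_def right_pcn_ineq_def
  by (meson le_mult_max_0 wnorm_nonneg max.cobounded2)

lemma is_pcn_iff:
  "1 \<le> q \<Longrightarrow> is_pcn posZ absZ posW absW p q S \<longleftrightarrow> (\<exists>C\<ge>0. pcn_ineq posZ absZ posW absW p q S C)"
  unfolding is_pcn_def pcn_ineq_def
  by (meson le_mult_max_0 absweak_nonneg max.cobounded2)

theorem theorem4p3:
  fixes p q :: real
    and T1 :: "'x::banach_lattice \<Rightarrow>\<^sub>L 'f::banach"
    and T2 :: "'e::banach \<Rightarrow>\<^sub>L 'y::banach_lattice"
    and T3 :: "'x \<Rightarrow>\<^sub>L 'y"
  assumes "1 \<le> q" and "q \<le> p"
  shows
   "(is_left_pcn lpos labs (ereal p) (ereal q) (blinfun_apply T1) \<longleftrightarrow>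
       is_right_pcn dpos dabs (conj_exp (ereal q)) (conj_exp (ereal p)) (adj T1))
    \<and> (is_left_pcn lpos labs (ereal p) (ereal q) (blinfun_apply T1) \<longrightarrow>
       left_pcn_norm lpos labs (ereal p) (ereal q) (blinfun_apply T1) =
       right_pcn_norm dpos dabs (conj_exp (ereal q)) (conj_exp (ereal p)) (adj T1))
    \<and> (is_right_pcn lpos labs (ereal p) (ereal q) (blinfun_apply T2) \<longleftrightarrow>
       is_left_pcn dpos dabs (conj_exp (ereal q)) (conj_exp (ereal p)) (adj T2))
    \<and> (is_right_pcn lpos labs (ereal p) (ereal q) (blinfun_apply T2) \<longrightarrow>
       right_pcn_norm lpos labs (ereal p) (ereal q) (blinfun_apply T2) =
       left_pcn_norm dpos dabs (conj_exp (ereal q)) (conj_exp (ereal p)) (adj T2))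
    \<and> (is_pcn lpos labs lpos labs (ereal p) (ereal q) (blinfun_apply T3) \<longleftrightarrow>
       is_pcn dpos dabs dpos dabs (conj_exp (ereal q)) (conj_exp (ereal p)) (adj T3))
    \<and> (is_pcn lpos labs lpos labs (ereal p) (ereal q) (blinfun_apply T3) \<longrightarrow>
       pcn_norm lpos labs lpos labs (ereal p) (ereal q) (blinfun_apply T3) =
       pcn_norm dpos dabs dpos dabs (conj_exp (ereal q)) (conj_exp (ereal p)) (adj T3))"
proof -
  have p: "1 \<le> ereal p" and q: "1 \<le> ereal q" "ereal q \<noteq> \<infinity>" using assms by auto
  note dual = one_le_conj_exp[OF p]
  show ?thesis
    \<comment> \<open>After unfolding, every claim concerns the set of admissible
      \<open>C \<ge> 0\<close>; \<open>conj_cong\<close> supplies \<open>0 \<le> C\<close> to the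
      equivalences, which make the sets and hence their infima equal.\<close>
    unfolding is_left_pcn_iff[OF q(1)] is_right_pcn_iff[OF q(1)] is_pcn_iff[OF q(1)]
      is_left_pcn_iff[OF dual] is_right_pcn_iff[OF dual] is_pcn_iff[OF dual]
      left_pcn_norm_def right_pcn_norm_def pcn_norm_def
    by (simp add: left_pcn_ineq_iff_adj[OF p q] right_pcn_ineq_iff_adj[OF p q(1)] pcn_ineq_iff_adj[OF p q]
      cong: conj_cong)
qed

end
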